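(* Let $p\ge3$ be a prime. (i) For all $n,k\ge0$ with $p\nmid n$, $$b\!\left(18p^{2\nu(p)(k+1)-1}n+\frac{9p^{2\nu(p)(k+1)}-1}{2}\right)\equiv 0\pmod{72}.$$ (ii) For all $k\ge0$, $$b\!\left(18p^{2\nu(p)k}+\frac{9p^{2\nu(p)k}-1}{2}\right)\equiv 36\,g(p)^k\pmod{72}.$$
   Context: The mock theta function $\mathcal{B}(q)=\sum_{n\ge0}\frac{q^n(-q;q^2)_n}{(q;q^2)_{n+1}}=\sum_{n\ge0}b(n)q^n$, $(a;q)_n=\prod_{j=0}^{n-1}(1-aq^j)$. The integers $a(n)$ are defined by $\sum_{n\ge0}a(n)q^n=f_1^4f_2$, $f_m:=(q^m;q^m)_\infty$. For a prime $p\ge3$: $r=r(p):=a\!\left(\frac{p^2-1}{4}\right)+(-1)^{\frac{p-1}{2}}\,p\left(\frac{(p^2-1)/4}{p}\right)$ (Legendre symbol), $s=s(p):=p^3$; $r$ is even. Set $\nu(p)=2$ if $r\equiv0\pmod 8$, $\nu(p)=4$ if $r\equiv4\pmod8$, $\nu(p)=8$ if $r\equiv2\pmod4$; and $g(p)=-s$ if $\nu(p)=2$, $g(p)=-r^2s+s^2$ if $\nu(p)=4$, $g(p)=-r^6s+5s^2r^4-6r^2s^3+s^4$ if $\nu(p)=8$. *)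

theory Defs
  imports "HOL-Computational_Algebra.Formal_Power_Series" "HOL-Number_Theory.Number_Theory"
begin

definition qpoch :: "int \<Rightarrow> nat \<Rightarrow> nat \<Rightarrow> nat \<Rightarrow> int fps" where
  "qpoch c e d n = (\<Prod>j<n. 1 - fps_const c * fps_X ^ (e + d * j))"

text \<open>The n-th summand q^n (-q;q^2)_n / (q;q^2)_{n+1}; the denominator has constant
  term 1, so it is inverted in int fps via fps_right_inverse with constant 1.\<close>
definition B_term :: "nat \<Rightarrow> int fps" where
  "B_term n = fps_X ^ n * qpoch (-1) 1 2 n * fps_right_inverse (qpoch 1 1 2 (Suc n)) 1"

text \<open>b(n): coefficient of q^n in B(q). The m-th summand has order \<ge> m, so the
  coefficient of q^n of the (formally convergent) series is the finite sum over m \<le> n.\<close>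
definition b :: "nat \<Rightarrow> int" where
  "b n = (\<Sum>m\<le>n. fps_nth (B_term m) n)"

text \<open>f_m = (q^m;q^m)_\<infinity> as a formal power series: the coefficient of q^n agrees with that
  of the finite product over j = 1..n (later factors are 1 mod q^(n+1)).\<close>
definition f_eta :: "nat \<Rightarrow> int fps" where
  "f_eta m = Abs_fps (\<lambda>n. fps_nth (\<Prod>j\<in>{1..n}. 1 - fps_X ^ (m * j)) n)"

definition a :: "nat \<Rightarrow> int" where
  "a n = fps_nth (f_eta 1 ^ 4 * f_eta 2) n"

definition r :: "nat \<Rightarrow> int" where
  "r p = a ((p^2 - 1) div 4)
         + (-1) ^ ((p - 1) div 2) * int p * Legendre (int ((p^2 - 1) div 4)) (int p)"

definition s :: "nat \<Rightarrow> int" where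
  "s p = int p ^ 3"

definition nu :: "nat \<Rightarrow> nat" where
  "nu p = (if r p mod 8 = 0 then 2 else if r p mod 8 = 4 then 4 else 8)"

definition g :: "nat \<Rightarrow> int" where
  "g p = (if nu p = 2 then - (s p)
          else if nu p = 4 then (s p)^2 - (r p)^2 * s p
          else (s p)^4 - (r p)^6 * s p + 5 * (s p)^2 * (r p)^4 - 6 * (r p)^2 * (s p)^3)"

end

theory Submission
  imports Defs "HOL-Computational_Algebra.Nth_Powers"
begin

text \<open>The sum $B(q)+B(-q)$ is a bilateral ${}_1\psi_1$ series, and Ramanujan's summation turns the even
  part of $B$ into $E(q)=\sum_n b(2n)q^n=\psi(q)^2/\varphi(-q)$. The 3-dissection of this quotient shows
  $9\mid b(6n+4)$. Since $\psi(q)^2=\varphi(q)\psi(q^2)$ and $\varphi(q)=\varphi(-q)+4\sum_{l\ {\rm odd}>0}q^{l^2}$,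
  one gets $E(q)\equiv\psi(q^2)(1+4\sum_{l\ {\rm odd}>0}q^{l^2})$ modulo 8, so that for nonsquare $m=4n+1$ the
  value $b(2n)$ is congruent modulo 8 to 4 times the number of $(x,y)$ with $x^2+4y^2=m$ and $y$ odd.
  By Zagier's involution the number of all $(x,y)$ with $x^2+4y^2=m$ has the parity of $\tau(m)/2$, where
  $\tau$ counts divisors; both parts of the theorem then follow by computing $\tau$
  at $9p^{2\nu(k+1)-1}(4n+p)$ and $45p^{2\nu k}$. Only the parity of $\nu(p)$ and $g(p)$ matters.\<close>

text \<open>The usual proofs of Ramanujan's summation let a complex parameter vary. Here the
  parameter runs only through powers q^c: a contiguous relation links c to c + 2, and since q^c
  tends to 0 X-adically, the sums for odd and for even c have the same limit. This compares c = 1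
  with c = 0, where the factor q^0 - q^0 removes the negative half of the series. The moduli 8 and 9
  are treated independently. The factor 9 of 4n + 1 forces n = 2 modulo 3, which is the class of the
  congruence modulo 9. Modulo 8, nonsquares appear because psi(q^2) has the exponents j(j + 1), and
  4j(j + 1) + 1 = (2j + 1)^2: for nonsquare 4n + 1 the leading term disappears and only a multiple
  of 4 remains, so that a parity decides. That parity is whether 4 divides the number of divisors.
  It does in the first part, where an even nu(p) makes the exponent of p congruent to 3 modulo 4,
  and it does not in the second, where this number is 2 modulo 4.\<close>

unbundle fps_syntax

section \<open>Formal power series\<close>

text \<open>Agreement to order n is expressed throughout as divisibility of a difference by
  \<open>fps_X ^ n\<close>, so that error estimates become applications of the rules for
  \<open>dvd\<close>.\<close>

lemma fps_X_power_dvd_iff: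
  fixes f :: "'a::comm_ring_1 fps"
  shows "fps_X ^ n dvd f \<longleftrightarrow> (\<forall>i<n. f $ i = 0)"
proof
  assume "\<forall>i<n. f $ i = 0"
  then have "f = fps_X ^ n * fps_shift n f"
    by (auto simp: fps_eq_iff fps_X_power_mult_nth)
  then show "fps_X ^ n dvd f" by (rule dvdI)
qed (auto simp: dvd_def fps_X_power_mult_nth)

lemma fps_X_dvd_iff: "fps_X dvd (f :: 'a::comm_ring_1 fps) \<longleftrightarrow> f $ 0 = 0"
  using fps_X_power_dvd_iff[of 1 f] by simp

lemma fps_X_power_dvd_diff_iff:
  fixes f g :: "'a::comm_ring_1 fps"
  shows "fps_X ^ n dvd f - g \<longleftrightarrow> (\<forall>i<n. f $ i = g $ i)"
  by (auto simp: fps_X_power_dvd_iff)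

lemma fps_X_power_dvd_power:
  "fps_X dvd (f :: 'a::comm_ring_1 fps) \<Longrightarrow> m \<le> n \<Longrightarrow> fps_X ^ m dvd f ^ n"
  by (meson dvd_power_same dvd_trans le_imp_power_dvd)

lemma fps_unit_inverse:
  fixes f :: "'a::comm_ring_1 fps"
  assumes "f $ 0 = 1"
  shows "f * fps_right_inverse f 1 = 1"
  using assms by (intro fps_right_inverse) simp

lemma fps_X_power_dvd_unit_mult:
  fixes f g :: "'a::comm_ring_1 fps"
  assumes "f $ 0 = 1" "fps_X ^ n dvd f * g"
  shows "fps_X ^ n dvd g"
proof -
  have "g = fps_right_inverse f 1 * (f * g)"
    using fps_unit_inverse[OF assms(1)] by (metis mult.assoc mult.commute mult_1)
  then show ?thesis using assms(2) by (metis dvd_mult)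
qed

text \<open>The substitute for clearing denominators over the integers: identities between terms of
  q-series are multiplied by their denominators, which have constant term 1.\<close>

lemma fps_cancel_unit:
  fixes f x y :: "'a::comm_ring_1 fps"
  assumes "f $ 0 = 1" "x * f = y * f"
  shows "x = y"
  using fps_unit_inverse[OF assms(1)] assms(2) by (metis mult.assoc mult_1_right)

text \<open>This is 1/f - 1/h = -(f - h)/(fh).\<close>

lemma dvd_unit_inverse_diff:
  fixes f h :: "'a::comm_ring_1 fps"
  assumes "f $ 0 = 1" "h $ 0 = 1" "d dvd f - h"
  shows "d dvd fps_right_inverse f 1 - fps_right_inverse h 1"
proof -
  let ?f = "fps_right_inverse f 1" and ?h = "fps_right_inverse h 1"
  have "?f - ?h = ?f * (h * ?h) - ?h * (f * ?f)"
    using assms by (simp only: fps_unit_inverse mult_1_right)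
  also have "\<dots> = (f - h) * (- (?f * ?h))" by (simp add: algebra_simps)
  finally show ?thesis using assms(3) by (metis dvd_mult2)
qed

lemma prod_fps_nth_0 [simp]:
  "(\<Prod>j\<in>A. f j :: 'a::comm_ring_1 fps) $ 0 = (\<Prod>j\<in>A. f j $ 0)"
  by (induction A rule: infinite_finite_induct) auto

lemma dvd_prod_diff:
  fixes f h :: "'a \<Rightarrow> 'b::comm_ring_1"
  assumes "\<And>i. i \<in> A \<Longrightarrow> d dvd f i - h i"
  shows "d dvd prod f A - prod h A"
  using assms
proof (induction A rule: infinite_finite_induct)
  case (insert x A)
  have "prod f (insert x A) - prod h (insert x A) =
      (f x - h x) * prod f A + h x * (prod f A - prod h A)"
    using insert.hyps by (simp add: algebra_simps)
  then show ?case using insert by simp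
qed simp_all

lemma int_fps_dvd_iff: "fps_const c dvd (f :: int fps) \<longleftrightarrow> (\<forall>n. c dvd f $ n)"
proof
  assume "\<forall>n. c dvd f $ n"
  then have "f = fps_const c * Abs_fps (\<lambda>n. f $ n div c)"
    by (simp add: fps_eq_iff)
  then show "fps_const c dvd f" by (rule dvdI)
qed (auto simp: dvd_def)

lemma fps_nth_compose_X_power:
  fixes f :: "'a::comm_ring_1 fps"
  assumes "m > 0"
  shows "(f oo fps_X ^ m) $ n = (if m dvd n then f $ (n div m) else 0)"
proof -
  have "(f oo fps_X ^ m) $ n = (\<Sum>i=0..n. if m * i = n then f $ i else 0)"
    by (auto simp: fps_compose_nth fps_X_power_nth simp flip: power_mult intro!: sum.cong)
  also have "\<dots> = (if m dvd n then f $ (n div m) else 0)"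
  proof (cases "m dvd n")
    case True
    then obtain k where "n = m * k" ..
    then show ?thesis using assms by (simp add: sum.delta)
  qed (auto intro!: sum.neutral)
  finally show ?thesis .
qed

lemma fps_compose_X_power_inject:
  fixes f h :: "'a::comm_ring_1 fps"
  assumes "m > 0" "f oo fps_X ^ m = h oo fps_X ^ m"
  shows "f = h"
proof (rule fps_ext)
  fix n
  show "f $ n = h $ n"
    using arg_cong[OF assms(2), of "\<lambda>F. F $ (m * n)"] assms(1)
    by (simp add: fps_nth_compose_X_power)
qed

section \<open>X-adic limits of power series\<close>

lemma LIMSEQ_fpsI:
  fixes g :: "'a::comm_ring_1 fps"
  assumes "\<And>n. fps_X ^ n dvd f n - g"
  shows "f \<longlonglongrightarrow> g"
proof (rule tendsto_fpsI)
  fix k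
  show "eventually (\<lambda>n. f n $ k = g $ k) sequentially"
    using eventually_gt_at_top[of k]
    by eventually_elim (use assms in \<open>auto simp: fps_X_power_dvd_diff_iff\<close>)
qed

lemma tendsto_fps_add:
  fixes f g :: "'b \<Rightarrow> 'a::comm_ring_1 fps"
  assumes "(f \<longlongrightarrow> F) G" "(g \<longlongrightarrow> H) G"
  shows "((\<lambda>x. f x + g x) \<longlongrightarrow> F + H) G"
proof (rule tendsto_fpsI)
  fix n
  show "eventually (\<lambda>x. (f x + g x) $ n = (F + H) $ n) G"
    using assms[unfolded tendsto_fps_iff, rule_format, of n] by eventually_elim simp
qed

lemma tendsto_fps_uminus:
  fixes f :: "'b \<Rightarrow> 'a::comm_ring_1 fps"
  assumes "(f \<longlongrightarrow> F) G"
  shows "((\<lambda>x. - f x) \<longlongrightarrow> - F) G"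
proof (rule tendsto_fpsI)
  fix n
  show "eventually (\<lambda>x. (- f x) $ n = (- F) $ n) G"
    using assms[unfolded tendsto_fps_iff, rule_format, of n] by eventually_elim simp
qed

lemma tendsto_fps_diff:
  fixes f g :: "'b \<Rightarrow> 'a::comm_ring_1 fps"
  assumes "(f \<longlongrightarrow> F) G" "(g \<longlongrightarrow> H) G"
  shows "((\<lambda>x. f x - g x) \<longlongrightarrow> F - H) G"
  using tendsto_fps_add[OF assms(1) tendsto_fps_uminus[OF assms(2)]] by simp

lemma tendsto_fps_mult:
  fixes f g :: "'b \<Rightarrow> 'a::comm_ring_1 fps"
  assumes "(f \<longlongrightarrow> F) G" "(g \<longlongrightarrow> H) G"
  shows "((\<lambda>x. f x * g x) \<longlongrightarrow> F * H) G"
proof (rule tendsto_fpsI)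
  fix n
  have "eventually (\<lambda>x. \<forall>i\<in>{..n}. f x $ i = F $ i) G"
    "eventually (\<lambda>x. \<forall>i\<in>{..n}. g x $ i = H $ i) G"
    using assms by (simp_all add: eventually_ball_finite_distrib tendsto_fps_iff)
  then show "eventually (\<lambda>x. (f x * g x) $ n = (F * H) $ n) G"
    by eventually_elim (simp add: fps_mult_nth)
qed

lemma tendsto_fps_compose:
  fixes f :: "'b \<Rightarrow> 'a::comm_ring_1 fps"
  assumes "(f \<longlongrightarrow> F) G"
  shows "((\<lambda>x. f x oo c) \<longlongrightarrow> (F oo c)) G"
proof (rule tendsto_fpsI)
  fix n
  have "eventually (\<lambda>x. \<forall>i\<in>{0..n}. f x $ i = F $ i) G"
    using assms by (simp add: eventually_ball_finite_distrib tendsto_fps_iff)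
  then show "eventually (\<lambda>x. (f x oo c) $ n = (F oo c) $ n) G"
    by eventually_elim (simp add: fps_compose_nth)
qed

text \<open>Step n changes only coefficients from n on, so coefficient k is final from index
  \<open>Suc k\<close> on. The same diagonal serves as the definition of \<open>qpinf\<close> and
  \<open>bil_sum\<close>.\<close>

lemma fps_seq_limit:
  fixes f :: "nat \<Rightarrow> 'a::comm_ring_1 fps"
  assumes "\<And>n. fps_X ^ n dvd f (Suc n) - f n"
  shows "fps_X ^ n dvd f n - Abs_fps (\<lambda>k. f (Suc k) $ k)"
proof -
  have step: "f (Suc m) $ k = f m $ k" if "k < m" for m k
    using assms[of m] that by (simp add: fps_X_power_dvd_diff_iff)
  have "f (Suc k + d) $ k = f (Suc k) $ k" for k d
    by (induction d) (auto simp: step)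
  then have "f n $ k = f (Suc k) $ k" if "k < n" for k
    using that by (metis Suc_leI le_add_diff_inverse)
  then show ?thesis by (simp add: fps_X_power_dvd_diff_iff)
qed

section \<open>Infinite products\<close>

text \<open>The symbol (x; Q)_infinity with an arbitrary series Q of constant term 0 as base; then
  factor i is 1 modulo \<open>fps_X ^ i\<close>, and k + 1 factors determine coefficient k. The
  series x may have a constant term: x = -1 occurs below.\<close>

definition qpinf :: "'a::comm_ring_1 fps \<Rightarrow> 'a fps \<Rightarrow> 'a fps" where
  "qpinf x Q = Abs_fps (\<lambda>k. (\<Prod>i<Suc k. 1 - x * Q ^ i) $ k)"

lemma qpinf_approx:
  assumes "Q $ 0 = 0"
  shows "fps_X ^ n dvd (\<Prod>i<n. 1 - x * Q ^ i) - qpinf x Q"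
  unfolding qpinf_def
proof (rule fps_seq_limit)
  fix n
  have "(\<Prod>i<Suc n. 1 - x * Q ^ i) - (\<Prod>i<n. 1 - x * Q ^ i) = Q ^ n * (- x * (\<Prod>i<n. 1 - x * Q ^ i))"
    by (simp add: algebra_simps)
  then show "fps_X ^ n dvd (\<Prod>i<Suc n. 1 - x * Q ^ i) - (\<Prod>i<n. 1 - x * Q ^ i)"
    using fps_X_power_dvd_power[of Q n n] assms by (simp add: fps_X_dvd_iff)
qed

lemma qpinf_LIMSEQ:
  "Q $ 0 = 0 \<Longrightarrow> (\<lambda>n. \<Prod>i<n. 1 - x * Q ^ i) \<longlonglongrightarrow> qpinf x Q"
  by (intro LIMSEQ_fpsI qpinf_approx)

lemma qpinf_nth_0: "x $ 0 = 0 \<Longrightarrow> qpinf x Q $ 0 = 1"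
  by (simp add: qpinf_def)

lemma qpinf_shift:
  assumes "Q $ 0 = 0"
  shows "qpinf x Q = (1 - x) * qpinf (x * Q) Q"
proof (rule LIMSEQ_unique)
  show "(\<lambda>n. \<Prod>i<Suc n. 1 - x * Q ^ i) \<longlonglongrightarrow> qpinf x Q"
    using LIMSEQ_Suc[OF qpinf_LIMSEQ[OF assms]] .
  have "(\<Prod>i<Suc n. 1 - x * Q ^ i) = (1 - x) * (\<Prod>i<n. 1 - x * Q * Q ^ i)" for n
    by (subst prod.lessThan_Suc_shift) (simp add: mult.assoc)
  then show "(\<lambda>n. \<Prod>i<Suc n. 1 - x * Q ^ i) \<longlonglongrightarrow> (1 - x) * qpinf (x * Q) Q"
    using tendsto_fps_mult[OF tendsto_const qpinf_LIMSEQ[OF assms]] by simp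
qed

lemma qpinf_split_2:
  assumes "Q $ 0 = 0"
  shows "qpinf x Q = qpinf x (Q ^ 2) * qpinf (x * Q) (Q ^ 2)"
proof (rule LIMSEQ_unique)
  show "(\<lambda>n. \<Prod>i<2*n. 1 - x * Q ^ i) \<longlonglongrightarrow> qpinf x Q"
    using LIMSEQ_subseq_LIMSEQ[OF qpinf_LIMSEQ[OF assms], of "\<lambda>n. 2 * n"]
    by (simp add: strict_mono_def o_def)
  have "(\<Prod>i<2*n. 1 - x * Q ^ i) = (\<Prod>i<n. 1 - x * (Q ^ 2) ^ i) * (\<Prod>i<n. 1 - x * Q * (Q ^ 2) ^ i)" for n
    by (induction n) (simp_all add: power_mult power_mult_distrib algebra_simps flip: power_mult)
  then show "(\<lambda>n. \<Prod>i<2*n. 1 - x * Q ^ i) \<longlonglongrightarrow> qpinf x (Q ^ 2) * qpinf (x * Q) (Q ^ 2)"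
    using tendsto_fps_mult[OF qpinf_LIMSEQ[of "Q^2" x] qpinf_LIMSEQ[of "Q^2" "x*Q"]] assms
    by (simp add: fps_power_zeroth)
qed

lemma qpinf_split_3:
  assumes "Q $ 0 = 0"
  shows "qpinf x Q = qpinf x (Q ^ 3) * qpinf (x * Q) (Q ^ 3) * qpinf (x * Q ^ 2) (Q ^ 3)"
proof (rule LIMSEQ_unique)
  show "(\<lambda>n. \<Prod>i<3*n. 1 - x * Q ^ i) \<longlonglongrightarrow> qpinf x Q"
    using LIMSEQ_subseq_LIMSEQ[OF qpinf_LIMSEQ[OF assms], of "\<lambda>n. 3 * n"]
    by (simp add: strict_mono_def o_def)
  have "(\<Prod>i<3*n. 1 - x * Q ^ i) = (\<Prod>i<n. 1 - x * (Q ^ 3) ^ i) * (\<Prod>i<n. 1 - x * Q * (Q ^ 3) ^ i)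
      * (\<Prod>i<n. 1 - x * Q ^ 2 * (Q ^ 3) ^ i)" for n
  proof (induction n)
    case (Suc n)
    have e: "3 * Suc n = Suc (Suc (Suc (3 * n)))" by simp
    have "(\<Prod>i<3*Suc n. 1 - x * Q ^ i) = (\<Prod>i<3*n. 1 - x * Q ^ i) * (1 - x * (Q ^ 3) ^ n)
       * (1 - x * Q * (Q ^ 3) ^ n) * (1 - x * Q ^ 2 * (Q ^ 3) ^ n)"
      unfolding e by (simp add: power2_eq_square mult_ac flip: power_mult)
    then show ?case unfolding Suc by (simp add: mult_ac)
  qed simp
  then show "(\<lambda>n. \<Prod>i<3*n. 1 - x * Q ^ i) \<longlonglongrightarrow> 
      qpinf x (Q ^ 3) * qpinf (x * Q) (Q ^ 3) * qpinf (x * Q ^ 2) (Q ^ 3)"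
    using assms by (simp add: tendsto_fps_mult qpinf_LIMSEQ fps_power_zeroth)
qed

lemma qpinf_mult_uminus:
  assumes "Q $ 0 = 0"
  shows "qpinf x Q * qpinf (- x) Q = qpinf (x ^ 2) (Q ^ 2)"
proof (rule LIMSEQ_unique)
  have "(\<Prod>i<n. 1 - x * Q ^ i) * (\<Prod>i<n. 1 - (- x) * Q ^ i) = (\<Prod>i<n. 1 - x ^ 2 * (Q ^ 2) ^ i)" for n
    unfolding prod.distrib[symmetric]
    by (intro prod.cong refl)
       (simp add: algebra_simps power2_eq_square power_mult_distrib)
  moreover have "(\<lambda>n. (\<Prod>i<n. 1 - x * Q ^ i) * (\<Prod>i<n. 1 - (- x) * Q ^ i)) \<longlonglongrightarrow> qpinf x Q * qpinf (- x) Q"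
    by (intro tendsto_fps_mult qpinf_LIMSEQ assms)
  ultimately show "(\<lambda>n. \<Prod>i<n. 1 - x ^ 2 * (Q ^ 2) ^ i) \<longlonglongrightarrow> qpinf x Q * qpinf (- x) Q" by simp
  show "(\<lambda>n. \<Prod>i<n. 1 - x ^ 2 * (Q ^ 2) ^ i) \<longlonglongrightarrow> qpinf (x ^ 2) (Q ^ 2)"
    using assms by (intro qpinf_LIMSEQ) (simp add: fps_power_zeroth)
qed

lemma qpinf_compose:
  fixes x Q c :: "'a::idom fps"
  assumes "Q $ 0 = 0" "c $ 0 = 0"
  shows "qpinf x Q oo c = qpinf (x oo c) (Q oo c)"
proof (rule LIMSEQ_unique)
  show "(\<lambda>n. (\<Prod>i<n. 1 - x * Q ^ i) oo c) \<longlonglongrightarrow> (qpinf x Q oo c)"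
    by (intro tendsto_fps_compose qpinf_LIMSEQ assms)
  have "(\<Prod>i<n. 1 - x * Q ^ i) oo c = (\<Prod>i<n. 1 - (x oo c) * (Q oo c) ^ i)" for n
    using assms(2) by (simp add: fps_compose_prod_distrib fps_compose_sub_distrib
        fps_compose_mult_distrib fps_compose_power)
  then show "(\<lambda>n. (\<Prod>i<n. 1 - x * Q ^ i) oo c) \<longlonglongrightarrow> qpinf (x oo c) (Q oo c)"
    using assms by (simp add: qpinf_LIMSEQ)
qed

text \<open>Euler's identity between partitions into odd and into distinct parts. It follows from
  (q;q)(-q;q) = (q^2;q^2) and (q;q) = (q;q^2)(q^2;q^2) by cancelling (q^2;q^2).\<close>

lemma qpinf_Euler:
  fixes q :: "'a::idom fps"
  assumes "q $ 0 = 0"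
  shows "qpinf q (q ^ 2) * qpinf (- q) q = 1"
proof -
  have "qpinf q (q ^ 2) * qpinf (- q) q * qpinf (q ^ 2) (q ^ 2) = qpinf (q ^ 2) (q ^ 2)"
    using qpinf_split_2[OF assms, of q] qpinf_mult_uminus[OF assms, of q]
    by (simp add: power2_eq_square mult_ac)
  moreover have "qpinf (q ^ 2) (q ^ 2) \<noteq> 0"
    using qpinf_nth_0[of "q ^ 2" "q ^ 2"] assms by (metis fps_nonzero_nth fps_square_nth zero_neq_one zero_power2 fps_power_zeroth)
  ultimately show ?thesis by simp
qed

section \<open>The even part of the mock theta function\<close>

text \<open>The terms of index $n \ge 0$ and $-m \le 0$ of the bilateral series
  $\sum_{n\in{\bf Z}} q^n (-q;q^2)_n/(q^{c+2};q^2)_n$; for negative indices the powers of $q$ are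
  distributed so that none of them is negative. The series for $c=1$ is $(1-q)(B(q)+B(-q))$, the one
  for $c=0$ is summed by the $q$-binomial theorem.\<close>

definition bil_pos :: "nat \<Rightarrow> nat \<Rightarrow> int fps" where
  "bil_pos c n = fps_X ^ n * (\<Prod>j<n. 1 + fps_X ^ (1 + 2 * j))
     * fps_right_inverse (\<Prod>j<n. 1 - fps_X ^ (c + 2 + 2 * j)) 1"

definition bil_neg :: "nat \<Rightarrow> nat \<Rightarrow> int fps" where
  "bil_neg c m = (\<Prod>j<m. fps_X ^ (2 * j) - fps_X ^ c)
     * fps_right_inverse (\<Prod>j<m. 1 + fps_X ^ (1 + 2 * j)) 1"

text \<open>The window from -N to N - 1: index 0 is already counted by \<open>bil_pos\<close>, so
  the negative half starts at \<open>Suc n\<close>. In this pairing both terms with number n are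
  divisible by q^n.\<close>

definition bil_partial :: "nat \<Rightarrow> nat \<Rightarrow> int fps" where
  "bil_partial c N = (\<Sum>n<N. bil_pos c n + bil_neg c (Suc n))"

definition bil_sum :: "nat \<Rightarrow> int fps" where
  "bil_sum c = Abs_fps (\<lambda>k. bil_partial c (Suc k) $ k)"

section \<open>The contiguous relation for the bilateral series\<close>

lemma bil_pos_mult:
  "bil_pos c n * (\<Prod>j<n. 1 - fps_X ^ (c + 2 + 2 * j)) = fps_X ^ n * (\<Prod>j<n. 1 + fps_X ^ (1 + 2 * j))"
proof -
  let ?P = "\<Prod>j<n. 1 - fps_X ^ (c + 2 + 2 * j) :: int fps"
  have "?P * fps_right_inverse ?P 1 = 1"
    by (rule fps_unit_inverse) simp
  then show ?thesis
    unfolding bil_pos_def by (simp only: mult.assoc mult.commute[of _ ?P]) simp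
qed

lemma bil_neg_mult:
  "bil_neg c n * (\<Prod>j<n. 1 + fps_X ^ (1 + 2 * j)) = (\<Prod>j<n. fps_X ^ (2 * j) - fps_X ^ c)"
proof -
  let ?P = "\<Prod>j<n. 1 + fps_X ^ (1 + 2 * j) :: int fps"
  have "?P * fps_right_inverse ?P 1 = 1"
    by (rule fps_unit_inverse) simp
  then show ?thesis
    unfolding bil_neg_def by (simp only: mult.assoc mult.commute[of _ ?P]) simp
qed

lemma bil_0 [simp]: "bil_pos c 0 = 1" "bil_neg c 0 = 1"
  using bil_pos_mult[of c 0] bil_neg_mult[of c 0] by simp_all

lemma bil_pos_Suc:
  "bil_pos c (Suc n) * (1 - fps_X ^ (c + 2 + 2 * n)) = fps_X * (1 + fps_X ^ (1 + 2 * n)) * bil_pos c n"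
proof (rule fps_cancel_unit)
  let ?P = "\<Prod>j<n. 1 - fps_X ^ (c + 2 + 2 * j) :: int fps"
  show "?P $ 0 = 1" by simp
  have "bil_pos c (Suc n) * (1 - fps_X ^ (c + 2 + 2 * n)) * ?P
      = bil_pos c (Suc n) * (\<Prod>j<Suc n. 1 - fps_X ^ (c + 2 + 2 * j))"
    by (simp only: prod.lessThan_Suc mult_ac)
  also have "\<dots> = fps_X * (1 + fps_X ^ (1 + 2 * n)) * (fps_X ^ n * (\<Prod>j<n. 1 + fps_X ^ (1 + 2 * j)))"
    unfolding bil_pos_mult by (simp only: prod.lessThan_Suc power_Suc mult_ac)
  also have "\<dots> = fps_X * (1 + fps_X ^ (1 + 2 * n)) * bil_pos c n * ?P"
    unfolding bil_pos_mult[of c n, symmetric] by (simp only: mult_ac)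
  finally show "bil_pos c (Suc n) * (1 - fps_X ^ (c + 2 + 2 * n)) * ?P = \<dots>" .
qed

text \<open>Splitting the product of n + 1 denominator factors at its first or at its last factor
  compares the parameters c and c + 2.\<close>

lemma bil_pos_shift:
  "bil_pos (c + 2) n * (1 - fps_X ^ (c + 2 + 2 * n)) = bil_pos c n * (1 - fps_X ^ (c + 2))"
proof (rule fps_cancel_unit)
  let ?P = "\<Prod>j<n. 1 - fps_X ^ (c + 2 + 2 * j) :: int fps"
  let ?P' = "\<Prod>j<n. 1 - fps_X ^ (c + 2 + 2 + 2 * j) :: int fps"
  show "(?P * ?P') $ 0 = 1" by simp
  have e: "?P * (1 - fps_X ^ (c + 2 + 2 * n)) = (1 - fps_X ^ (c + 2)) * ?P'"
    using prod.lessThan_Suc_shift[of "\<lambda>j. 1 - fps_X ^ (c + 2 + 2 * j) :: int fps" n]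
    by (simp add: add_ac)
  have "bil_pos (c + 2) n * (1 - fps_X ^ (c + 2 + 2 * n)) * (?P * ?P') =
      (bil_pos (c + 2) n * ?P') * (?P * (1 - fps_X ^ (c + 2 + 2 * n)))" by (simp only: mult_ac)
  also have "\<dots> = (bil_pos c n * ?P) * ((1 - fps_X ^ (c + 2)) * ?P')"
    unfolding bil_pos_mult e ..
  finally show "bil_pos (c + 2) n * (1 - fps_X ^ (c + 2 + 2 * n)) * (?P * ?P')
      = bil_pos c n * (1 - fps_X ^ (c + 2)) * (?P * ?P')" by (simp only: mult_ac)
qed

lemma bil_neg_Suc:
  "bil_neg c (Suc n) * (1 + fps_X ^ (1 + 2 * n)) = bil_neg c n * (fps_X ^ (2 * n) - fps_X ^ c)"
proof (rule fps_cancel_unit)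
  let ?P = "\<Prod>j<n. 1 + fps_X ^ (1 + 2 * j) :: int fps"
  show "?P $ 0 = 1" by simp
  have "bil_neg c (Suc n) * (1 + fps_X ^ (1 + 2 * n)) * ?P
      = bil_neg c (Suc n) * (\<Prod>j<Suc n. 1 + fps_X ^ (1 + 2 * j))"
    by (simp only: prod.lessThan_Suc mult_ac)
  also have "\<dots> = (\<Prod>j<n. fps_X ^ (2 * j) - fps_X ^ c) * (fps_X ^ (2 * n) - fps_X ^ c)"
    unfolding bil_neg_mult by (simp only: prod.lessThan_Suc)
  also have "\<dots> = bil_neg c n * (fps_X ^ (2 * n) - fps_X ^ c) * ?P"
    unfolding bil_neg_mult[of c n, symmetric] by (simp only: mult_ac)
  finally show "bil_neg c (Suc n) * (1 + fps_X ^ (1 + 2 * n)) * ?P = \<dots>" .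
qed

text \<open>Taking q^2 out of every numerator factor except the one with j = 0 turns c + 2 into c
  and lowers the index by one.\<close>

lemma bil_neg_shift:
  "bil_neg (c + 2) (Suc n) * (1 + fps_X ^ (1 + 2 * n)) = (1 - fps_X ^ (c + 2)) * fps_X ^ (2 * n) * bil_neg c n"
proof (rule fps_cancel_unit)
  let ?P = "\<Prod>j<n. 1 + fps_X ^ (1 + 2 * j) :: int fps"
  show "?P $ 0 = 1" by simp
  have "(\<Prod>j<Suc n. fps_X ^ (2 * j) - fps_X ^ (c + 2) :: int fps) =
      (1 - fps_X ^ (c + 2)) * (\<Prod>j<n. fps_X ^ (2 * Suc j) - fps_X ^ (c + 2))"
    by (subst prod.lessThan_Suc_shift) simp
  also have "(\<Prod>j<n. fps_X ^ (2 * Suc j) - fps_X ^ (c + 2) :: int fps) =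
      (\<Prod>j<n. fps_X ^ 2 * (fps_X ^ (2 * j) - fps_X ^ c))"
    by (intro prod.cong refl) (simp add: power_add algebra_simps power2_eq_square)
  also have "\<dots> = fps_X ^ (2 * n) * (\<Prod>j<n. fps_X ^ (2 * j) - fps_X ^ c)"
    by (simp add: prod.distrib power_mult)
  finally have e: "(\<Prod>j<Suc n. fps_X ^ (2 * j) - fps_X ^ (c + 2) :: int fps) =
      (1 - fps_X ^ (c + 2)) * fps_X ^ (2 * n) * (bil_neg c n * ?P)"
    unfolding bil_neg_mult by (simp only: mult.assoc)
  show "bil_neg (c + 2) (Suc n) * (1 + fps_X ^ (1 + 2 * n)) * ?P =
      (1 - fps_X ^ (c + 2)) * fps_X ^ (2 * n) * bil_neg c n * ?P"
    using bil_neg_mult[of "c + 2" "Suc n", unfolded e]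
    by (simp only: prod.lessThan_Suc mult_ac)
qed

lemma ring_diff_mult_mult: "w * (x - y) * u = w * (x * u - y * (u :: 'a::comm_ring))"
  by (simp add: algebra_simps)

text \<open>The weights of the terms for c and c + 2 are chosen so that their combination
  telescopes. After multiplication by the last denominator \<open>?u\<close>, every term is a
  multiple of \<open>bil_pos c n\<close>, and a polynomial identity in q, q^c and q^(2n)
  remains.\<close>

lemma bil_pos_step:
  "(1 + fps_X ^ c) * (1 - fps_X ^ (c + 2)) * bil_pos c n - (1 + fps_X ^ (c + 1)) * bil_pos (c + 2) n
    = (1 - fps_X ^ (c + 2)) * fps_X ^ c * (bil_pos c n - bil_pos c (Suc n))"
proof (rule fps_cancel_unit)
  let ?u = "1 - fps_X ^ (c + 2 + 2 * n) :: int fps" and ?w = "1 - fps_X ^ (c + 2) :: int fps"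
  show "?u $ 0 = 1" by simp
  have "((1 + fps_X ^ c) * ?w * bil_pos c n - (1 + fps_X ^ (c + 1)) * bil_pos (c + 2) n) * ?u
     = (1 + fps_X ^ c) * ?w * bil_pos c n * ?u - (1 + fps_X ^ (c + 1)) * (bil_pos (c + 2) n * ?u)"
    by (simp only: left_diff_distrib mult.assoc)
  also have "\<dots> = ?w * fps_X ^ c * (bil_pos c n * ?u - fps_X * (1 + fps_X ^ (1 + 2 * n)) * bil_pos c n)"
    unfolding bil_pos_shift by (simp add: power_add algebra_simps power2_eq_square)
  also have "\<dots> = ?w * fps_X ^ c * (bil_pos c n - bil_pos c (Suc n)) * ?u"
    unfolding ring_diff_mult_mult bil_pos_Suc ..
  finally show "((1 + fps_X ^ c) * ?w * bil_pos c n - (1 + fps_X ^ (c + 1)) * bil_pos (c + 2) n) * ?u = \<dots>" .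
qed

lemma bil_neg_step:
  "(1 + fps_X ^ c) * (1 - fps_X ^ (c + 2)) * bil_neg c (Suc n)
     - (1 + fps_X ^ (c + 1)) * bil_neg (c + 2) (Suc n)
    = (1 - fps_X ^ (c + 2)) * fps_X ^ c * (bil_neg c (Suc n) - bil_neg c n)"
proof (rule fps_cancel_unit)
  let ?u = "1 + fps_X ^ (1 + 2 * n) :: int fps" and ?w = "1 - fps_X ^ (c + 2) :: int fps"
  show "?u $ 0 = 1" by simp
  have "((1 + fps_X ^ c) * ?w * bil_neg c (Suc n) - (1 + fps_X ^ (c + 1)) * bil_neg (c + 2) (Suc n)) * ?u
     = (1 + fps_X ^ c) * ?w * (bil_neg c (Suc n) * ?u) - (1 + fps_X ^ (c + 1)) * (bil_neg (c + 2) (Suc n) * ?u)"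
    by (simp only: left_diff_distrib mult.assoc)
  also have "\<dots> = ?w * fps_X ^ c * (bil_neg c n * (fps_X ^ (2 * n) - fps_X ^ c) - bil_neg c n * ?u)"
    unfolding bil_neg_shift unfolding bil_neg_Suc by (simp add: power_add algebra_simps power2_eq_square)
  also have "\<dots> = ?w * fps_X ^ c * (bil_neg c (Suc n) - bil_neg c n) * ?u"
    unfolding ring_diff_mult_mult bil_neg_Suc ..
  finally show "((1 + fps_X ^ c) * ?w * bil_neg c (Suc n) - (1 + fps_X ^ (c + 1)) * bil_neg (c + 2) (Suc n)) * ?u = \<dots>" .
qed

text \<open>Both step lemmas are the same telescoping identity, with $T_n = -q^c$ times the $n$-th term.\<close>

lemma bil_partial_step:
  "(1 + fps_X ^ c) * (1 - fps_X ^ (c + 2)) * bil_partial c N - (1 + fps_X ^ (c + 1)) * bil_partial (c + 2) N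
    = (1 - fps_X ^ (c + 2)) * fps_X ^ c * (bil_neg c N - bil_pos c N)"
proof (induction N)
  case (Suc N)
  have "(1 + fps_X ^ c) * (1 - fps_X ^ (c + 2)) * bil_partial c (Suc N) - (1 + fps_X ^ (c + 1)) * bil_partial (c + 2) (Suc N)
     = ((1 + fps_X ^ c) * (1 - fps_X ^ (c + 2)) * bil_partial c N - (1 + fps_X ^ (c + 1)) * bil_partial (c + 2) N)
     + ((1 + fps_X ^ c) * (1 - fps_X ^ (c + 2)) * bil_pos c N - (1 + fps_X ^ (c + 1)) * bil_pos (c + 2) N)
     + ((1 + fps_X ^ c) * (1 - fps_X ^ (c + 2)) * bil_neg c (Suc N) - (1 + fps_X ^ (c + 1)) * bil_neg (c + 2) (Suc N))"
    unfolding bil_partial_def sum.lessThan_Suc by (simp only: distrib_left) simp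
  also have "\<dots> = (1 - fps_X ^ (c + 2)) * fps_X ^ c * ((bil_neg c N - bil_pos c N)
      + (bil_pos c N - bil_pos c (Suc N)) + (bil_neg c (Suc N) - bil_neg c N))"
    unfolding Suc bil_pos_step bil_neg_step distrib_left ..
  finally show ?case by simp
qed (simp add: bil_partial_def)

lemma X_power_dvd_bil_pos: "fps_X ^ n dvd bil_pos c n"
  by (simp add: bil_pos_def mult.assoc)

text \<open>For c > 0 all numerator factors except the one with j = 0 have constant term 0; for c =
  0 the factor with j = 0 vanishes.\<close>

lemma X_power_dvd_bil_neg: "fps_X ^ n dvd bil_neg c (Suc n)"
proof (cases "c = 0")
  case True
  then show ?thesis unfolding bil_neg_def by (subst prod.lessThan_Suc_shift) simp
next
  case False
  have "fps_X ^ n = (\<Prod>j<n. fps_X :: int fps)" by simp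
  also have "\<dots> dvd (\<Prod>j<n. fps_X ^ (2 * Suc j) - fps_X ^ c)"
    using False by (intro prod_dvd_prod) (simp add: fps_X_dvd_iff)
  finally show ?thesis
    unfolding bil_neg_def by (subst prod.lessThan_Suc_shift) (simp add: dvd_mult dvd_mult2 del: power_Suc mult_Suc_right)
qed

lemma bil_sum_approx: "fps_X ^ n dvd bil_partial c n - bil_sum c"
  unfolding bil_sum_def
  by (rule fps_seq_limit)
     (simp add: bil_partial_def X_power_dvd_bil_pos X_power_dvd_bil_neg)

lemma bil_sum_shift:
  "bil_sum c * ((1 + fps_X ^ c) * (1 - fps_X ^ (c + 2))) = (1 + fps_X ^ (c + 1)) * bil_sum (c + 2)"
proof -
  \<comment> \<open>The window ends at \<open>Suc N\<close> because the order estimate for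
    \<open>bil_neg\<close> is stated at successors. By \<open>bil_partial_step\<close>,
    \<open>h\<close> is a boundary term and tends to 0.\<close>
  define h where "h N = (1 + fps_X ^ c) * (1 - fps_X ^ (c + 2)) * bil_partial c (Suc N)
     - (1 + fps_X ^ (c + 1)) * bil_partial (c + 2) (Suc N)" for N
  have "bil_partial c' \<longlonglongrightarrow> bil_sum c'" for c'
    by (intro LIMSEQ_fpsI bil_sum_approx)
  then have "h \<longlonglongrightarrow> (1 + fps_X ^ c) * (1 - fps_X ^ (c + 2)) * bil_sum c
      - (1 + fps_X ^ (c + 1)) * bil_sum (c + 2)"
    unfolding h_def by (intro tendsto_fps_diff tendsto_fps_mult tendsto_const LIMSEQ_Suc)
  moreover have "h \<longlonglongrightarrow> 0"
  proof (rule LIMSEQ_fpsI)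
    fix n
    have "fps_X ^ n dvd bil_neg c (Suc n) - bil_pos c (Suc n)"
      using X_power_dvd_bil_neg[of n c] X_power_dvd_bil_pos[of "Suc n" c]
      by (meson dvd_diff dvd_trans le_imp_power_dvd le_SucI order_refl)
    then show "fps_X ^ n dvd h n - 0"
      unfolding h_def bil_partial_step by simp
  qed
  ultimately show ?thesis
    using LIMSEQ_unique by (force simp: mult_ac)
qed

text \<open>Modulo \<open>fps_X ^ n\<close> all q^c with c at least n are 0. This links odd and even
  values of c, which steps of length 2 never do.\<close>

lemma bil_sum_cong:
  assumes "n \<le> c" "n \<le> c'"
  shows "fps_X ^ n dvd bil_sum c - bil_sum c'"
proof -
  have pow: "fps_X ^ n dvd (fps_X ^ i - fps_X ^ j :: int fps)" if "n \<le> i" "n \<le> j" for i j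
    using that by (simp add: dvd_diff le_imp_power_dvd)
  have pos: "fps_X ^ n dvd bil_pos c k - bil_pos c' k" for k
  proof -
    have "fps_X ^ n dvd (fps_right_inverse (\<Prod>j<k. 1 - fps_X ^ (c + 2 + 2 * j)) 1
        - fps_right_inverse (\<Prod>j<k. 1 - fps_X ^ (c' + 2 + 2 * j)) 1 :: int fps)"
    proof (rule dvd_unit_inverse_diff)
      show "fps_X ^ n dvd (\<Prod>j<k. 1 - fps_X ^ (c + 2 + 2 * j)) 
          - (\<Prod>j<k. 1 - fps_X ^ (c' + 2 + 2 * j) :: int fps)"
      proof (rule dvd_prod_diff)
        fix i
        show "fps_X ^ n dvd (1 - fps_X ^ (c + 2 + 2 * i)) - (1 - fps_X ^ (c' + 2 + 2 * i) :: int fps)"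
          using pow[of "c' + 2 + 2 * i" "c + 2 + 2 * i"] assms by simp
      qed
    qed simp_all
    then show ?thesis
      unfolding bil_pos_def by (simp only: right_diff_distrib[symmetric] dvd_mult)
  qed
  have neg: "fps_X ^ n dvd bil_neg c k - bil_neg c' k" for k
  proof -
    have "fps_X ^ n dvd (\<Prod>j<k. fps_X ^ (2 * j) - fps_X ^ c) - (\<Prod>j<k. fps_X ^ (2 * j) - fps_X ^ c' :: int fps)"
    proof (rule dvd_prod_diff)
      fix i
      show "fps_X ^ n dvd fps_X ^ (2 * i) - fps_X ^ c - (fps_X ^ (2 * i) - fps_X ^ c' :: int fps)"
        using pow[OF assms(2,1)] by simp
    qed
    then show ?thesis
      unfolding bil_neg_def by (simp only: left_diff_distrib[symmetric] dvd_mult2)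
  qed
  have "fps_X ^ n dvd bil_partial c n - bil_partial c' n"
    unfolding bil_partial_def sum_subtractf[symmetric]
    by (intro dvd_sum) (metis (no_types) pos neg add_diff_add dvd_add)
  moreover have "bil_sum c - bil_sum c' = (bil_partial c n - bil_partial c' n)
      - (bil_partial c n - bil_sum c) + (bil_partial c' n - bil_sum c')" by simp
  ultimately show ?thesis
    using bil_sum_approx by (metis dvd_add dvd_diff)
qed

lemma bil_sum_iterate:
  "bil_sum c * ((\<Prod>k<n. 1 + fps_X ^ (c + 2 * k)) * (\<Prod>k<n. 1 - fps_X ^ (c + 2 + 2 * k)))
     = (\<Prod>k<n. 1 + fps_X ^ (c + 1 + 2 * k)) * bil_sum (c + 2 * n)"
proof (induction n)
  case (Suc n)
  have "bil_sum c * ((\<Prod>k<Suc n. 1 + fps_X ^ (c + 2 * k)) * (\<Prod>k<Suc n. 1 - fps_X ^ (c + 2 + 2 * k)))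
     = bil_sum c * ((\<Prod>k<n. 1 + fps_X ^ (c + 2 * k)) * (\<Prod>k<n. 1 - fps_X ^ (c + 2 + 2 * k)))
       * ((1 + fps_X ^ (c + 2 * n)) * (1 - fps_X ^ (c + 2 + 2 * n)))"
    by (simp only: prod.lessThan_Suc mult_ac)
  also have "\<dots> = (\<Prod>k<n. 1 + fps_X ^ (c + 1 + 2 * k)) * 
      (bil_sum (c + 2 * n) * ((1 + fps_X ^ (c + 2 * n)) * (1 - fps_X ^ (c + 2 * n + 2))))"
    unfolding Suc by (simp add: mult_ac add_ac)
  also have "\<dots> = (\<Prod>k<Suc n. 1 + fps_X ^ (c + 1 + 2 * k)) * bil_sum (c + 2 * Suc n)"
    unfolding bil_sum_shift by (simp add: mult_ac add_ac)
  finally show ?case .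
qed simp

lemma qpinf_X_LIMSEQ:
  "(\<lambda>n. \<Prod>k<n. 1 - fps_X ^ (c + 2 * k)) \<longlonglongrightarrow> qpinf (fps_X ^ c :: int fps) (fps_X ^ 2)"
  "(\<lambda>n. \<Prod>k<n. 1 + fps_X ^ (c + 2 * k)) \<longlonglongrightarrow> qpinf (- (fps_X ^ c) :: int fps) (fps_X ^ 2)"
  using qpinf_LIMSEQ[of "fps_X ^ 2" "fps_X ^ c :: int fps"] qpinf_LIMSEQ[of "fps_X ^ 2" "- (fps_X ^ c) :: int fps"]
  by (simp_all add: power_add power_mult)

text \<open>The relation is iterated from c = 1 and from c = 0, and each result is multiplied by the
  finite product on the right of the other. The tails \<open>bil_sum (1 + 2 * n)\<close> and
  \<open>bil_sum (0 + 2 * n)\<close> then have the same cofactor, so only their difference matters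
  and the value of their common limit does not have to be known.\<close>

lemma bil_sum_1_0:
  "bil_sum 1 * (qpinf (- fps_X) (fps_X ^ 2) * qpinf (fps_X ^ 3) (fps_X ^ 2)) * qpinf (- fps_X) (fps_X ^ 2)
   = bil_sum 0 * (qpinf (- 1) (fps_X ^ 2) * qpinf (fps_X ^ 2) (fps_X ^ 2)) * qpinf (- (fps_X ^ 2)) (fps_X ^ 2)"
  (is "?L = ?R")
proof -
  define u v w where "u c n = (\<Prod>k<n. 1 + fps_X ^ (c + 2 * k) :: int fps)"
    and "v c n = (\<Prod>k<n. 1 - fps_X ^ (c + 2 + 2 * k) :: int fps)"
    and "w c n = (\<Prod>k<n. 1 + fps_X ^ (c + 1 + 2 * k) :: int fps)" for c n
  define h where "h n = bil_sum 1 * (u 1 n * v 1 n) * w 0 n - bil_sum 0 * (u 0 n * v 0 n) * w 1 n" for n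
  have "u 1 \<longlonglongrightarrow> qpinf (- fps_X) (fps_X ^ 2)" "v 1 \<longlonglongrightarrow> qpinf (fps_X ^ 3) (fps_X ^ 2)"
    "w 0 \<longlonglongrightarrow> qpinf (- fps_X) (fps_X ^ 2)" "u 0 \<longlonglongrightarrow> qpinf (- 1) (fps_X ^ 2)"
    "v 0 \<longlonglongrightarrow> qpinf (fps_X ^ 2) (fps_X ^ 2)" "w 1 \<longlonglongrightarrow> qpinf (- (fps_X ^ 2)) (fps_X ^ 2)"
    unfolding u_def v_def w_def
    using qpinf_X_LIMSEQ(2)[of 1] qpinf_X_LIMSEQ(1)[of "1+2"] qpinf_X_LIMSEQ(2)[of "0+1"]
      qpinf_X_LIMSEQ(2)[of 0] qpinf_X_LIMSEQ(1)[of "0+2"] qpinf_X_LIMSEQ(2)[of "1+1"]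
    by (simp_all add: numeral_eq_Suc)
  then have "h \<longlonglongrightarrow> ?L - ?R"
    unfolding h_def by (intro tendsto_fps_diff tendsto_fps_mult tendsto_const)
  moreover have "h \<longlonglongrightarrow> 0"
  proof (rule LIMSEQ_fpsI)
    fix n
    have e: "bil_sum c * (u c n * v c n) = w c n * bil_sum (c + 2 * n)" for c
      unfolding u_def v_def w_def by (rule bil_sum_iterate)
    have "h n = w 1 n * w 0 n * (bil_sum (1 + 2 * n) - bil_sum (0 + 2 * n))"
      unfolding h_def e by (simp only: right_diff_distrib mult_ac)
    then show "fps_X ^ n dvd h n - 0"
      using bil_sum_cong[of n "1 + 2 * n" "0 + 2 * n"] by simp
  qed
  ultimately have "?L - ?R = 0" by (rule LIMSEQ_unique)
  then show ?thesis by (rule eq_iff_diff_eq_0[THEN iffD2])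
qed

text \<open>The q-binomial theorem F(z) = (az; q^2)/(z; q^2) at a = -q, z = q, obtained by iterating
  (1 - z) F(z) = (1 - az) F(q^2 z). The series \<open>G k N\<close> is F at z = q^(2k+1), truncated
  after N terms, and \<open>step\<close> is the functional equation with its truncation
  error.\<close>

lemma bil_sum_0: "bil_sum 0 * qpinf fps_X (fps_X ^ 2) = qpinf (- (fps_X ^ 2)) (fps_X ^ 2)"
proof -
  define G where "G k N = (\<Sum>n<N. fps_X ^ (2 * k * n) * bil_pos 0 n)" for k N
  have step: "(1 - fps_X ^ (2 * k + 1)) * G k N - (1 + fps_X ^ (2 * k + 2)) * G (Suc k) N
      = - (fps_X ^ (2 * k * N) * bil_pos 0 N * (1 - fps_X ^ (2 * N)))" for k N
  proof (induction N)
    case (Suc N)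
    have "fps_X ^ (2 * k * Suc N) * bil_pos 0 (Suc N) * (1 - fps_X ^ (2 * Suc N)) =
       fps_X ^ (2 * k * N) * fps_X ^ (2 * k) * (bil_pos 0 (Suc N) * (1 - fps_X ^ (0 + 2 + 2 * N)))"
      by (simp add: power_add mult_ac)
    also have "\<dots> = fps_X ^ (2 * k * N) * fps_X ^ (2 * k) * fps_X * (1 + fps_X ^ (1 + 2 * N)) * bil_pos 0 N"
      unfolding bil_pos_Suc by (simp only: mult.assoc)
    finally have e: "fps_X ^ (2 * k * Suc N) * bil_pos 0 (Suc N) * (1 - fps_X ^ (2 * Suc N)) = \<dots>" .
    have "(1 - fps_X ^ (2 * k + 1)) * G k (Suc N) - (1 + fps_X ^ (2 * k + 2)) * G (Suc k) (Suc N)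
      = ((1 - fps_X ^ (2 * k + 1)) * G k N - (1 + fps_X ^ (2 * k + 2)) * G (Suc k) N)
       + ((1 - fps_X ^ (2 * k + 1)) - (1 + fps_X ^ (2 * k + 2)) * fps_X ^ (2 * N))
          * (fps_X ^ (2 * k * N) * bil_pos 0 N)"
      by (simp add: G_def algebra_simps power_add)
    also have "\<dots> = - (fps_X ^ (2 * k * N) * fps_X ^ (2 * k) * fps_X * (1 + fps_X ^ (1 + 2 * N)) * bil_pos 0 N)"
      unfolding Suc by (simp add: power_add power2_eq_square algebra_simps)
    finally show ?case unfolding e .
  qed (simp add: G_def)
  \<comment> \<open>Each of the k applications of \<open>step\<close> adds an error containing
    \<open>bil_pos 0 N\<close>, hence divisible by q^N.\<close>
  have iter: "fps_X ^ N dvd (\<Prod>j<k. 1 - fps_X ^ (1 + 2 * j)) * G 0 N - (\<Prod>j<k. 1 + fps_X ^ (2 + 2 * j)) * G k N" for k N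
  proof (induction k)
    case (Suc k)
    let ?A = "\<Prod>j<k. 1 - fps_X ^ (1 + 2 * j) :: int fps" and ?B = "\<Prod>j<k. 1 + fps_X ^ (2 + 2 * j) :: int fps"
    have "(\<Prod>j<Suc k. 1 - fps_X ^ (1 + 2 * j)) * G 0 N - (\<Prod>j<Suc k. 1 + fps_X ^ (2 + 2 * j)) * G (Suc k) N
      = (?A * G 0 N - ?B * G k N) * (1 - fps_X ^ (2 * k + 1))
        + ?B * ((1 - fps_X ^ (2 * k + 1)) * G k N - (1 + fps_X ^ (2 * k + 2)) * G (Suc k) N)"
      by (simp add: algebra_simps)
    moreover have "fps_X ^ N dvd ?B * ((1 - fps_X ^ (2 * k + 1)) * G k N - (1 + fps_X ^ (2 * k + 2)) * G (Suc k) N)"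
      unfolding step using X_power_dvd_bil_pos[of N 0] by (simp add: dvd_mult dvd_mult2)
    ultimately show ?case using Suc by (simp del: prod.lessThan_Suc)
  qed simp
  \<comment> \<open>At z = q^(2N+1) every term except the first carries a factor q^(2N).\<close>
  have G: "fps_X ^ N dvd G N N - 1" for N
  proof (cases N)
    case (Suc M)
    have "fps_X ^ N dvd (\<Sum>n<M. fps_X ^ (2 * N * Suc n) * bil_pos 0 (Suc n))"
      by (intro dvd_sum dvd_mult2 le_imp_power_dvd) simp
    then show ?thesis unfolding G_def Suc by (subst sum.lessThan_Suc_shift) simp
  qed simp
  have "bil_neg 0 (Suc n) = 0" for n
    unfolding bil_neg_def by (subst prod.lessThan_Suc_shift) simp
  then have G0: "bil_partial 0 N = G 0 N" for N by (simp add: bil_partial_def G_def)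
  define h where "h N = (\<Prod>j<N. 1 - fps_X ^ (1 + 2 * j)) * bil_partial 0 N - (\<Prod>j<N. 1 + fps_X ^ (2 + 2 * j))" for N
  have "bil_partial 0 \<longlonglongrightarrow> bil_sum 0"
    by (intro LIMSEQ_fpsI bil_sum_approx)
  then have "h \<longlonglongrightarrow> qpinf (fps_X ^ 1) (fps_X ^ 2) * bil_sum 0 - qpinf (- (fps_X ^ 2)) (fps_X ^ 2)"
    unfolding h_def by (intro tendsto_fps_diff tendsto_fps_mult qpinf_X_LIMSEQ)
  moreover have "h \<longlonglongrightarrow> 0"
  proof (rule LIMSEQ_fpsI)
    fix N
    have "h N = (\<Prod>j<N. 1 - fps_X ^ (1 + 2 * j)) * G 0 N - (\<Prod>j<N. 1 + fps_X ^ (2 + 2 * j)) * G N N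
       + (\<Prod>j<N. 1 + fps_X ^ (2 + 2 * j)) * (G N N - 1)"
      unfolding h_def G0 by (simp add: algebra_simps)
    moreover have "fps_X ^ N dvd (\<Prod>j<N. 1 + fps_X ^ (2 + 2 * j)) * (G N N - 1)"
      using G by (rule dvd_mult)
    ultimately show "fps_X ^ N dvd h N - 0" using iter[of N N] by simp
  qed
  ultimately have "qpinf (fps_X ^ 1) (fps_X ^ 2) * bil_sum 0 - qpinf (- (fps_X ^ 2)) (fps_X ^ 2) = 0"
    by (rule LIMSEQ_unique)
  then show ?thesis by (simp add: mult_ac)
qed

section \<open>The product formula for the even part of B\<close>

definition B_even :: "int fps" where
  "B_even = Abs_fps (\<lambda>n. b (2 * n))"

lemma B_term_mult:
  "B_term n * (\<Prod>j<Suc n. 1 - fps_X ^ (1 + 2 * j)) = fps_X ^ n * (\<Prod>j<n. 1 + fps_X ^ (1 + 2 * j))"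
proof -
  let ?P = "\<Prod>j<Suc n. 1 - fps_X ^ (1 + 2 * j) :: int fps"
  have "fps_const (- 1 :: int) = - 1" by (simp flip: fps_const_neg)
  then have "B_term n = fps_X ^ n * (\<Prod>j<n. 1 + fps_X ^ (1 + 2 * j)) * fps_right_inverse ?P 1"
    by (simp add: B_term_def qpoch_def)
  moreover have "fps_right_inverse ?P 1 * ?P = 1"
    using fps_unit_inverse[of ?P] by (simp del: prod.lessThan_Suc add: mult.commute)
  ultimately show ?thesis by (simp only: mult.assoc) simp
qed

lemma B_term_bil_pos: "(1 - fps_X) * B_term n = bil_pos 1 n"
proof (rule fps_cancel_unit)
  let ?P = "\<Prod>j<n. 1 - fps_X ^ (1 + 2 + 2 * j) :: int fps"
  show "?P $ 0 = 1" by simp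
  have "(\<Prod>j<Suc n. 1 - fps_X ^ (1 + 2 * j) :: int fps) = (1 - fps_X) * ?P"
    by (subst prod.lessThan_Suc_shift) simp
  then have "(1 - fps_X) * B_term n * ?P = B_term n * (\<Prod>j<Suc n. 1 - fps_X ^ (1 + 2 * j))"
    by (simp only: mult_ac)
  also have "\<dots> = bil_pos 1 n * ?P"
    unfolding B_term_mult bil_pos_mult ..
  finally show "(1 - fps_X) * B_term n * ?P = bil_pos 1 n * ?P" .
qed

text \<open>At -q the n-th summand is (-q)^n (q;q^2)_n/(-q;q^2)_(n+1), the bilateral term of index
  -(n+1) up to the factor 1 - q: the power (-q)^n is distributed over the numerator through -q(1 -
  q^(1+2j)) = q^(2j+2) - q.\<close>

lemma B_term_bil_neg: "(1 - fps_X) * (B_term n oo - fps_X) = bil_neg 1 (Suc n)"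
proof (rule fps_cancel_unit)
  let ?P = "\<Prod>j<Suc n. 1 + fps_X ^ (1 + 2 * j) :: int fps"
  show "?P $ 0 = 1" by simp
  have pow: "(fps_X :: int fps) ^ k oo - fps_X = (- fps_X) ^ k" for k
    by (simp flip: fps_compose_power)
  have "(B_term n * (\<Prod>j<Suc n. 1 - fps_X ^ (1 + 2 * j))) oo - fps_X = (B_term n oo - fps_X) * ?P"
    by (simp add: fps_compose_mult_distrib fps_compose_prod_distrib fps_compose_sub_distrib pow
        del: prod.lessThan_Suc)
  moreover have "(fps_X ^ n * (\<Prod>j<n. 1 + fps_X ^ (1 + 2 * j)) :: int fps) oo - fps_X
      = (- fps_X) ^ n * (\<Prod>j<n. 1 - fps_X ^ (1 + 2 * j))"
    by (simp add: fps_compose_mult_distrib fps_compose_prod_distrib fps_compose_add_distrib pow)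
  ultimately have "(B_term n oo - fps_X) * ?P = (- fps_X) ^ n * (\<Prod>j<n. 1 - fps_X ^ (1 + 2 * j))"
    unfolding B_term_mult by (simp only:)
  moreover have "(- fps_X) ^ n * (\<Prod>j<n. 1 - fps_X ^ (1 + 2 * j) :: int fps)
      = (\<Prod>j<n. fps_X ^ (2 * Suc j) - fps_X)"
  proof -
    have "(- fps_X) ^ n * (\<Prod>j<n. 1 - fps_X ^ (1 + 2 * j) :: int fps)
        = (\<Prod>j<n. - fps_X * (1 - fps_X ^ (1 + 2 * j)))"
      by (simp only: prod.distrib prod_constant card_lessThan)
    also have "\<dots> = (\<Prod>j<n. fps_X ^ (2 * Suc j) - fps_X)"
      by (intro prod.cong refl) (simp add: algebra_simps)
    finally show ?thesis .
  qed
  moreover have "(\<Prod>j<Suc n. fps_X ^ (2 * j) - fps_X ^ 1 :: int fps)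
      = (1 - fps_X) * (\<Prod>j<n. fps_X ^ (2 * Suc j) - fps_X)"
    by (subst prod.lessThan_Suc_shift) simp
  ultimately show "(1 - fps_X) * (B_term n oo - fps_X) * ?P = bil_neg 1 (Suc n) * ?P"
    unfolding bil_neg_mult by (simp only: mult.assoc)
qed

lemma B_even_bil_sum: "(1 - fps_X) * (2 * (B_even oo fps_X ^ 2)) = bil_sum 1"
proof (rule LIMSEQ_unique)
  let ?B = "Abs_fps b"
  have "(\<lambda>N. \<Sum>n<N. B_term n) \<longlonglongrightarrow> ?B"
  proof (rule LIMSEQ_fpsI)
    fix N
    have "(\<Sum>n<N. B_term n) $ i = b i" if "i < N" for i
    proof -
      have "(\<Sum>n<N. B_term n $ i) = (\<Sum>n\<le>i. B_term n $ i)"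
        using that by (intro sum.mono_neutral_right)
          (auto simp: B_term_def fps_X_power_mult_nth mult.assoc)
      then show ?thesis by (simp add: b_def fps_sum_nth)
    qed
    then show "fps_X ^ N dvd (\<Sum>n<N. B_term n) - ?B"
      by (simp add: fps_X_power_dvd_diff_iff)
  qed
  then have "(\<lambda>N. (1 - fps_X) * ((\<Sum>n<N. B_term n) + ((\<Sum>n<N. B_term n) oo - fps_X)))
      \<longlonglongrightarrow> (1 - fps_X) * (?B + (?B oo - fps_X))"
    by (intro tendsto_fps_mult tendsto_fps_add tendsto_fps_compose tendsto_const)
  moreover have "(1 - fps_X) * ((\<Sum>n<N. B_term n) + ((\<Sum>n<N. B_term n) oo - fps_X)) = bil_partial 1 N" for N
    unfolding bil_partial_def B_term_bil_pos[symmetric] B_term_bil_neg[symmetric]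
    by (simp add: fps_compose_sum_distrib sum.distrib sum_distrib_left distrib_left)
  moreover have "(2 * F) $ n = 2 * F $ n" for F :: "int fps" and n
    by (simp only: mult_2 fps_add_nth)
  then have "?B + (?B oo - fps_X) = 2 * (B_even oo fps_X ^ 2)"
    by (auto simp: fps_eq_iff fps_compose_uminus' fps_nth_compose_X_power B_even_def)
  ultimately show "bil_partial 1 \<longlonglongrightarrow> (1 - fps_X) * (2 * (B_even oo fps_X ^ 2))" by simp
  show "bil_partial 1 \<longlonglongrightarrow> bil_sum 1" by (intro LIMSEQ_fpsI bil_sum_approx)
qed

text \<open>The identity is proved with q^2 for q, since \<open>bil_sum 1\<close> only contains
  E(q^2). The 2 in B(q) + B(-q) = 2E(q^2) cancels against the 2 in (-1; q^2) = 2(-q^2; q^2).\<close>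

lemma B_even_product:
  "B_even * qpinf fps_X (fps_X ^ 2) ^ 2 = qpinf (- fps_X) fps_X ^ 3 * qpinf fps_X fps_X"
proof (rule fps_compose_X_power_inject)
  let ?A = "qpinf fps_X (fps_X ^ 2) :: int fps" and ?C = "qpinf (- fps_X) (fps_X ^ 2) :: int fps"
  let ?V = "qpinf (- (fps_X ^ 2)) (fps_X ^ 2) :: int fps" and ?P = "qpinf (fps_X ^ 2) (fps_X ^ 2) :: int fps"
  let ?E = "B_even oo fps_X ^ 2" and ?D = "qpinf (fps_X ^ 2) (fps_X ^ 4) :: int fps"
  have A: "?A = (1 - fps_X) * qpinf (fps_X ^ 3) (fps_X ^ 2)"
    using qpinf_shift[of "fps_X ^ 2" fps_X] by (simp add: numeral_eq_Suc)
  have M: "qpinf (- 1) (fps_X ^ 2) = 2 * ?V"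
    using qpinf_shift[of "fps_X ^ 2" "- 1 :: int fps"] by simp
  have D: "?A * ?C = ?D"
    using qpinf_mult_uminus[of "fps_X ^ 2 :: int fps" fps_X] by (simp flip: power_mult)
  have D2: "?D ^ 2 = (?A * ?C) * (?A * ?C)" unfolding D by (rule power2_eq_square)
  have "2 * (?E * ?D ^ 2) = 2 * ?E * ?A * ?C * ?C * ((1 - fps_X) * qpinf (fps_X ^ 3) (fps_X ^ 2))"
    unfolding D2 A[symmetric] by (simp only: mult_ac)
  also have "\<dots> = bil_sum 1 * (?C * qpinf (fps_X ^ 3) (fps_X ^ 2)) * ?C * ?A"
    unfolding B_even_bil_sum[symmetric] by (simp only: mult_ac)
  also have "\<dots> = (bil_sum 0 * ?A) * (2 * ?V * ?P * ?V)"
    unfolding bil_sum_1_0 M by (simp only: mult_ac)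
  also have "\<dots> = 2 * (?V ^ 3 * ?P)"
    unfolding bil_sum_0 by (simp add: power3_eq_cube mult_ac)
  finally have "?E * ?D ^ 2 = ?V ^ 3 * ?P" by simp
  then show "(B_even * ?A ^ 2) oo fps_X ^ 2 = (qpinf (- fps_X) fps_X ^ 3 * qpinf fps_X fps_X) oo fps_X ^ 2"
    by (simp add: fps_compose_mult_distrib qpinf_compose fps_compose_uminus
        flip: fps_compose_power power_mult)
qed simp

section \<open>The Jacobi triple product\<close>

text \<open>The Gaussian binomial coefficient, given by a q-Pascal rule instead of a quotient so
  that it makes sense for every ring element Q.\<close>

fun qbinomial :: "'a::comm_ring_1 \<Rightarrow> nat \<Rightarrow> nat \<Rightarrow> 'a" where
  "qbinomial Q n 0 = 1"
| "qbinomial Q 0 (Suc k) = 0"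
| "qbinomial Q (Suc n) (Suc k) = qbinomial Q n (Suc k) + Q ^ (n - k) * qbinomial Q n k"

lemma qbinomial_eq_0: "n < k \<Longrightarrow> qbinomial Q n k = 0"
  by (induction Q n k rule: qbinomial.induct) auto

text \<open>The second q-Pascal rule. In the finite triple product the defining rule adds a factor
  containing x, this one a factor containing y.\<close>

lemma qbinomial_Suc_Suc':
  "qbinomial Q (Suc n) (Suc k) = Q ^ Suc k * qbinomial Q n (Suc k) + qbinomial Q n k"
proof (induction n arbitrary: k)
  case 0
  then show ?case by (cases k) auto
next
  case (Suc n)
  show ?case
  proof (cases k)
    case 0
    have "qbinomial Q (Suc (Suc n)) (Suc 0) = qbinomial Q (Suc n) (Suc 0) + Q ^ Suc n"
      by simp
    also have "\<dots> = Q * qbinomial Q n (Suc 0) + 1 + Q ^ Suc n"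
      unfolding Suc[of 0] by simp
    also have "\<dots> = Q * (qbinomial Q n (Suc 0) + Q ^ n) + 1"
      by (simp add: distrib_left add_ac)
    finally show ?thesis using 0 by simp
  next
    case (Suc l)
    show ?thesis
    proof (cases "k \<le> n")
      case True
      then have e: "Q ^ (Suc n - k) * Q ^ k = Q ^ Suc k * Q ^ (n - k)"
        by (simp flip: power_add power_Suc)
      have "qbinomial Q (Suc (Suc n)) (Suc k) = qbinomial Q (Suc n) (Suc k) + Q ^ (Suc n - k) * qbinomial Q (Suc n) k"
        by simp
      also have "\<dots> = Q ^ Suc k * qbinomial Q n (Suc k) + qbinomial Q n k
          + Q ^ (Suc n - k) * (Q ^ k * qbinomial Q n k + qbinomial Q n l)"
        using Suc.IH[of k] Suc.IH[of l] Suc by (simp only:)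
      also have "\<dots> = Q ^ Suc k * qbinomial Q n (Suc k) + qbinomial Q n k
          + Q ^ Suc k * Q ^ (n - k) * qbinomial Q n k + Q ^ (Suc n - k) * qbinomial Q n l"
        unfolding e[symmetric] by (simp only: distrib_left mult.assoc add.assoc)
      also have "\<dots> = Q ^ Suc k * qbinomial Q (Suc n) (Suc k) + qbinomial Q (Suc n) k"
        using Suc by (simp add: algebra_simps)
      finally show ?thesis .
    next
      case False
      then show ?thesis using Suc by (auto simp: qbinomial_eq_0)
    qed
  qed
qed

lemma qbinomial_mult:
  assumes "k \<le> n"
  shows "(\<Prod>i<k. 1 - Q ^ Suc i) * (\<Prod>i<n - k. 1 - Q ^ Suc i) * qbinomial Q n k = (\<Prod>i<n. 1 - Q ^ Suc i)"
  using assms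
proof (induction n arbitrary: k)
  case (Suc n)
  let ?P = "\<lambda>n. \<Prod>i<n. 1 - Q ^ Suc i"
  show ?case
  proof (cases k)
    case (Suc l)
    have l: "l \<le> n" using Suc Suc.prems by simp
    have 1: "?P (Suc l) * ?P (n - l) * qbinomial Q n (Suc l) = (1 - Q ^ (n - l)) * ?P n"
    proof (cases "l < n")
      case True
      then have "n - l = Suc (n - Suc l)" by simp
      then have "?P (n - l) = ?P (n - Suc l) * (1 - Q ^ (n - l))" by simp
      then have "?P (Suc l) * ?P (n - l) * qbinomial Q n (Suc l)
          = (1 - Q ^ (n - l)) * (?P (Suc l) * ?P (n - Suc l) * qbinomial Q n (Suc l))"
        by (simp only: mult_ac)
      then show ?thesis unfolding Suc.IH[OF Suc_leI[OF True]] .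
    qed (use l in \<open>simp add: qbinomial_eq_0\<close>)
    have "?P (Suc l) * ?P (n - l) * qbinomial Q n l = (1 - Q ^ Suc l) * (?P l * ?P (n - l) * qbinomial Q n l)"
      by (simp only: prod.lessThan_Suc mult_ac)
    then have 2: "?P (Suc l) * ?P (n - l) * qbinomial Q n l = (1 - Q ^ Suc l) * ?P n"
      unfolding Suc.IH[OF l] .
    have "?P (Suc l) * ?P (n - l) * qbinomial Q (Suc n) (Suc l)
        = ?P (Suc l) * ?P (n - l) * qbinomial Q n (Suc l)
        + Q ^ (n - l) * (?P (Suc l) * ?P (n - l) * qbinomial Q n l)"
      by (simp only: qbinomial.simps distrib_left mult_ac)
    also have "\<dots> = (1 - Q ^ (n - l) * Q ^ Suc l) * ?P n"
      unfolding 1 2 by (simp add: algebra_simps)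
    also have "Q ^ (n - l) * Q ^ Suc l = Q ^ Suc n" using l by (simp flip: power_add power_Suc)
    finally show ?thesis using Suc by (simp add: mult.commute)
  qed simp
qed simp

section \<open>Theta series and the passage to the infinite product\<close>

definition triangular :: "int \<Rightarrow> nat" where
  "triangular k = nat (k * (k + 1) div 2)"

lemma triangular: "2 * int (triangular k) = k * (k + 1)"
proof -
  have "k * (k + 1) \<ge> 0" by (cases "k \<ge> 0") (auto simp: mult_nonpos_nonpos)
  moreover have "even (k * (k + 1))" by simp
  ultimately show ?thesis unfolding triangular_def by (auto elim!: evenE)
qed

lemma triangular_diff: "int (triangular k) - int (triangular (k - 1)) = k"
  using triangular[of k] triangular[of "k - 1"] by (simp add: algebra_simps)

text \<open>The general term of Ramanujan's theta function f(x, y). Two variables x and y, in place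
  of q and z, keep all exponents nonnegative.\<close>

definition theta_term :: "'a::comm_ring_1 \<Rightarrow> 'a \<Rightarrow> int \<Rightarrow> 'a" where
  "theta_term x y k = x ^ triangular k * y ^ triangular (k - 1)"

text \<open>The quotient of the terms k and k - 1 is x^k y^(k-1). Multiplying by a suitable power of
  xy removes negative exponents for k of either sign.\<close>

lemma theta_term_mult_pred:
  assumes "k \<le> int m + 1"
  shows "theta_term x y k * (x * y) ^ nat (int m + 1 - k) = theta_term x y (k - 1) * (x * (x * y) ^ m)"
proof -
  have "triangular k + nat (int m + 1 - k) = triangular (k - 1) + Suc m"
    "triangular (k - 1) + nat (int m + 1 - k) = triangular (k - 2) + m"
    using assms triangular_diff[of k] triangular_diff[of "k - 1"] by auto
  then have "x ^ (triangular k + nat (int m + 1 - k)) * y ^ (triangular (k - 1) + nat (int m + 1 - k))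
     = x ^ (triangular (k - 1) + Suc m) * y ^ (triangular (k - 2) + m)" by (simp only:)
  then show ?thesis
    by (simp add: theta_term_def power_add power_mult_distrib mult_ac)
qed

lemma theta_term_mult_succ:
  assumes "- int n \<le> k"
  shows "theta_term x y (k - 1) * (x * y) ^ nat (int n + k) = theta_term x y k * (y * (x * y) ^ n)"
proof -
  have "triangular (k - 1) + nat (int n + k) = triangular k + n"
    "triangular (k - 2) + nat (int n + k) = triangular (k - 1) + Suc n"
    using assms triangular_diff[of k] triangular_diff[of "k - 1"] by auto
  then have "x ^ (triangular (k - 1) + nat (int n + k)) * y ^ (triangular (k - 2) + nat (int n + k))
     = x ^ (triangular k + n) * y ^ (triangular (k - 1) + Suc n)" by (simp only:)
  then show ?thesis
    by (simp add: theta_term_def power_add power_mult_distrib mult_ac)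
qed

text \<open>Independent m and n allow an induction that adds a single factor at a time; each new
  factor is absorbed by one of the two q-Pascal rules.\<close>

lemma finite_triple_product:
  "(\<Prod>i<m. 1 + x * (x * y) ^ i) * (\<Prod>i<n. 1 + y * (x * y) ^ i)
    = (\<Sum>j\<le>m + n. theta_term x y (int j - int n) * qbinomial (x * y) (m + n) j)"
proof (induction m)
  case 0
  show ?case
  proof (induction n)
    case 0
    show ?case by (simp add: theta_term_def triangular_def)
  next
    case (Suc n)
    let ?t = "theta_term x y" and ?Q = "x * y"
    have "(\<Sum>j\<le>Suc n. ?t (int j - int (Suc n)) * qbinomial ?Q (Suc n) j)
        = ?t (- int (Suc n)) + (\<Sum>j\<le>n. ?t (int j - int n) * qbinomial ?Q (Suc n) (Suc j))"
      by (subst sum.atMost_Suc_shift) simp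
    also have "\<dots> = ?t (- int (Suc n)) + (\<Sum>j\<le>n. ?t (int j - int n) * ?Q ^ Suc j * qbinomial ?Q n (Suc j))
        + (\<Sum>j\<le>n. ?t (int j - int n) * qbinomial ?Q n j)"
      unfolding qbinomial_Suc_Suc' by (simp only: distrib_left sum.distrib mult.assoc add.assoc)
    also have "?t (- int (Suc n)) + (\<Sum>j\<le>n. ?t (int j - int n) * ?Q ^ Suc j * qbinomial ?Q n (Suc j))
        = (\<Sum>j\<le>Suc n. ?t (int j - int (Suc n)) * ?Q ^ j * qbinomial ?Q n j)"
      by (subst sum.atMost_Suc_shift) simp
    also have "\<dots> = (\<Sum>j\<le>n. ?t (int j - int (Suc n)) * ?Q ^ j * qbinomial ?Q n j)"
      by (simp add: qbinomial_eq_0)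
    also have "\<dots> = (\<Sum>j\<le>n. ?t (int j - int n) * qbinomial ?Q n j) * (y * ?Q ^ n)"
      unfolding sum_distrib_right
    proof (intro sum.cong refl)
      fix j
      have "?t (int j - int (Suc n)) * ?Q ^ j = ?t (int j - int n) * (y * ?Q ^ n)"
        using theta_term_mult_succ[of n "int j - int n" x y] by (simp add: algebra_simps)
      then show "?t (int j - int (Suc n)) * ?Q ^ j * qbinomial ?Q n j
          = ?t (int j - int n) * qbinomial ?Q n j * (y * ?Q ^ n)" by (simp only: mult_ac)
    qed
    finally show ?case using Suc by (simp add: distrib_left add.commute)
  qed
next
  case (Suc m)
  let ?t = "theta_term x y" and ?Q = "x * y" and ?N = "m + n"
  have "(\<Sum>j\<le>Suc ?N. ?t (int j - int n) * qbinomial ?Q (Suc ?N) j)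
      = ?t (- int n) + (\<Sum>j\<le>?N. ?t (int (Suc j) - int n) * qbinomial ?Q (Suc ?N) (Suc j))"
    by (subst sum.atMost_Suc_shift) simp
  also have "\<dots> = ?t (- int n) + (\<Sum>j\<le>?N. ?t (int (Suc j) - int n) * qbinomial ?Q ?N (Suc j))
      + (\<Sum>j\<le>?N. ?t (int (Suc j) - int n) * ?Q ^ (?N - j) * qbinomial ?Q ?N j)"
    unfolding qbinomial.simps by (simp only: distrib_left sum.distrib mult.assoc add.assoc)
  also have "?t (- int n) + (\<Sum>j\<le>?N. ?t (int (Suc j) - int n) * qbinomial ?Q ?N (Suc j))
      = (\<Sum>j\<le>Suc ?N. ?t (int j - int n) * qbinomial ?Q ?N j)"
    by (subst sum.atMost_Suc_shift) simp
  also have "\<dots> = (\<Sum>j\<le>?N. ?t (int j - int n) * qbinomial ?Q ?N j)"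
    by (simp add: qbinomial_eq_0)
  also have "(\<Sum>j\<le>?N. ?t (int (Suc j) - int n) * ?Q ^ (?N - j) * qbinomial ?Q ?N j)
      = (\<Sum>j\<le>?N. ?t (int j - int n) * qbinomial ?Q ?N j) * (x * ?Q ^ m)"
    unfolding sum_distrib_right
  proof (intro sum.cong refl)
    fix j assume "j \<in> {..?N}"
    then have "nat (int m + 1 - (int (Suc j) - int n)) = ?N - j" by auto
    then have "?t (int (Suc j) - int n) * ?Q ^ (?N - j) = ?t (int j - int n) * (x * ?Q ^ m)"
      using theta_term_mult_pred[of "int (Suc j) - int n" m x y] \<open>j \<in> {..?N}\<close> by (simp add: algebra_simps)
    then show "?t (int (Suc j) - int n) * ?Q ^ (?N - j) * qbinomial ?Q ?N j
        = ?t (int j - int n) * qbinomial ?Q ?N j * (x * ?Q ^ m)" by (simp only: mult_ac)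
  qed
  finally have "(\<Sum>j\<le>Suc ?N. ?t (int j - int n) * qbinomial ?Q (Suc ?N) j)
     = (\<Sum>j\<le>?N. ?t (int j - int n) * qbinomial ?Q ?N j) * (1 + x * ?Q ^ m)"
    by (simp add: distrib_left)
  then show ?case unfolding Suc[symmetric] by (simp add: mult_ac)
qed

text \<open>A linear bound for the quadratic exponents suffices for convergence. It comes from the
  fact that products of consecutive integers are nonnegative.\<close>

lemma dvd_theta_term: "(x * y) ^ nat (\<bar>k\<bar> - 1) dvd theta_term x y k"
proof -
  have "int (triangular j) \<ge> \<bar>j\<bar> - 1 \<and> int (triangular j) \<ge> \<bar>j + 1\<bar> - 1" for j
  proof -
    have "2 * (\<bar>j\<bar> - 1) \<le> j * (j + 1)" "2 * (\<bar>j + 1\<bar> - 1) \<le> j * (j + 1)"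
    proof -
      have "0 \<le> (j - 1) * j" "0 \<le> (j + 1) * (j + 2)"
        by (cases "j \<ge> 1"; simp add: mult_nonpos_nonpos)+
           (cases "j \<ge> -1"; simp add: mult_nonpos_nonpos)
      then show "2 * (\<bar>j\<bar> - 1) \<le> j * (j + 1)" "2 * (\<bar>j + 1\<bar> - 1) \<le> j * (j + 1)"
        by (auto simp: abs_if algebra_simps)
    qed
    then show ?thesis using triangular[of j] by simp
  qed
  from this[of k] this[of "k - 1"] show ?thesis
    unfolding theta_term_def power_mult_distrib
    by (intro mult_dvd_mono le_imp_power_dvd) auto
qed

text \<open>In the finite identity with m = n, the q-binomial coefficient times (Q;Q)_infinity is 1
  up to order min(j, 2n - j) only, which is poor at both ends of the sum. There the theta term
  itself has order about |j - n|, and the two orders add up to at least n - 1.\<close>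

lemma triple_product:
  fixes x y :: "'a::comm_ring_1 fps"
  assumes "(x * y) $ 0 = 0"
  shows "(\<lambda>n. \<Sum>k=-int n..int n. theta_term x y k) \<longlonglongrightarrow>
    qpinf (- x) (x * y) * qpinf (- y) (x * y) * qpinf (x * y) (x * y)"
proof -
  define Q where "Q = x * y"
  define P where "P n = (\<Prod>i<n. 1 - Q ^ Suc i)" for n
  have Q: "Q $ 0 = 0" and XQ: "fps_X dvd Q" using assms by (simp_all add: Q_def fps_X_dvd_iff)
  let ?I = "qpinf Q Q" and ?t = "theta_term x y"
  have I0: "?I $ 0 = 1" using Q by (rule qpinf_nth_0)
  have P: "fps_X ^ n dvd P m - ?I" if "n \<le> m" for m n
    using qpinf_approx[OF Q, of m Q] that unfolding P_def
    by (auto intro: dvd_trans[OF le_imp_power_dvd])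
  have approx: "fps_X ^ (n - 1) dvd ?t (int j - int n) * (qbinomial Q (n + n) j * ?I - 1)" if "j \<le> n + n" for n j
  proof -
    define l where "l = min j (n + n - j)"
    \<comment> \<open>Multiplying by the unit \<open>?I\<close> makes the quotient formula
      \<open>qbinomial_mult\<close> applicable: all errors become differences between finite
      products \<open>P\<close> and their limit \<open>?I\<close>.\<close>
    have "?I * (qbinomial Q (n + n) j * ?I - 1) = qbinomial Q (n + n) j * (?I * ?I) - ?I"
      by (simp add: algebra_simps)
    also have "\<dots> = qbinomial Q (n + n) j * (- (P j - ?I) * P (n + n - j) - ?I * (P (n + n - j) - ?I)) + (P (n + n) - ?I)"
      using qbinomial_mult[of j "n + n" Q] that by (simp add: P_def algebra_simps)
    finally have eq: "?I * (qbinomial Q (n + n) j * ?I - 1) = \<dots>" .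
    have p: "fps_X ^ l dvd P j - ?I" "fps_X ^ l dvd P (n + n - j) - ?I" "fps_X ^ l dvd P (n + n) - ?I"
      using that unfolding l_def by (auto intro: P)
    have "fps_X ^ l dvd - (P j - ?I) * P (n + n - j)"
      using p(1) by (metis dvd_minus_iff dvd_mult2)
    then have "fps_X ^ l dvd ?I * (qbinomial Q (n + n) j * ?I - 1)"
      unfolding eq by (intro dvd_add[OF dvd_mult[OF dvd_diff] p(3)] dvd_mult[OF p(2)])
    then have "fps_X ^ l dvd qbinomial Q (n + n) j * ?I - 1"
      by (rule fps_X_power_dvd_unit_mult[OF I0])
    moreover have "fps_X ^ nat (\<bar>int j - int n\<bar> - 1) dvd ?t (int j - int n)"
      using dvd_theta_term[of x y "int j - int n"] XQ unfolding Q_def[symmetric]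
      by (meson dvd_trans dvd_power_same)
    ultimately have "fps_X ^ (nat (\<bar>int j - int n\<bar> - 1) + l) dvd ?t (int j - int n) * (qbinomial Q (n + n) j * ?I - 1)"
      unfolding power_add by (intro mult_dvd_mono)
    moreover have "n - 1 \<le> nat (\<bar>int j - int n\<bar> - 1) + l"
      using that unfolding l_def by linarith
    ultimately show ?thesis by (meson dvd_trans le_imp_power_dvd)
  qed
  define h where "h n = (\<Prod>i<n. 1 - (- x) * Q ^ i) * (\<Prod>i<n. 1 - (- y) * Q ^ i) * ?I" for n
  define S where "S n = (\<Sum>k=-int n..int n. ?t k)" for n
  have S: "S n = (\<Sum>j\<le>n + n. ?t (int j - int n))" for n
    unfolding S_def by (rule sum.reindex_bij_witness[of _ "\<lambda>j. int j - int n" "\<lambda>k. nat (k + int n)"]) auto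
  have "h n = (\<Sum>j\<le>n + n. ?t (int j - int n) * (qbinomial Q (n + n) j * ?I))" for n
    using finite_triple_product[of x y n n] unfolding h_def Q_def
    by (simp add: sum_distrib_right mult.assoc)
  then have "h n - S n = (\<Sum>j\<le>n + n. ?t (int j - int n) * (qbinomial Q (n + n) j * ?I - 1))" for n
    unfolding S by (simp add: sum_subtractf right_diff_distrib)
  then have "fps_X ^ (n - 1) dvd h n - S n" for n
    using approx[of _ n] by (simp only:) (rule dvd_sum, simp)
  from this[of "Suc _"] have "fps_X ^ n dvd h (Suc n) - S (Suc n) - 0" for n
    by simp
  then have "(\<lambda>n. h (Suc n) - S (Suc n)) \<longlonglongrightarrow> 0" by (rule LIMSEQ_fpsI)
  then have "(\<lambda>n. h n - S n) \<longlonglongrightarrow> 0" by (rule LIMSEQ_imp_Suc)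
  moreover have "h \<longlonglongrightarrow> qpinf (- x) Q * qpinf (- y) Q * ?I"
    unfolding h_def using Q by (intro tendsto_fps_mult qpinf_LIMSEQ tendsto_const)
  ultimately have "(\<lambda>n. h n - (h n - S n)) \<longlonglongrightarrow> qpinf (- x) Q * qpinf (- y) Q * ?I - 0"
    by (intro tendsto_fps_diff)
  then show ?thesis by (simp add: S_def Q_def)
qed

section \<open>Theta functions and the congruence modulo 9\<close>

text \<open>Ramanujan's $\varphi(cq)$ (for $c=\pm 1$) and $\psi(q)$, defined by their product sides.\<close>

definition phi :: "int \<Rightarrow> int fps" where
  "phi c = qpinf (- (fps_const c * fps_X)) (fps_X ^ 2) ^ 2 * qpinf (fps_X ^ 2) (fps_X ^ 2)"

definition psi :: "int fps" where
  "psi = qpinf (- fps_X) fps_X ^ 2 * qpinf fps_X fps_X"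

lemma theta_term_square: "theta_term x x k = x ^ nat (k\<^sup>2)"
proof -
  have "triangular k + triangular (k - 1) = nat (k\<^sup>2)"
    using triangular[of k] triangular[of "k - 1"] by (simp add: algebra_simps power2_eq_square)
  then show ?thesis by (simp add: theta_term_def flip: power_add)
qed

lemma phi_LIMSEQ:
  assumes "c ^ 2 = 1"
  shows "(\<lambda>n. \<Sum>k=-int n..int n. (fps_const c * fps_X) ^ nat (k\<^sup>2)) \<longlonglongrightarrow> phi c"
proof -
  have e: "(fps_const c * fps_X) * (fps_const c * fps_X) = (fps_X ^ 2 :: int fps)"
    using assms by (simp add: power2_eq_square mult_ac fps_const_mult[symmetric] flip: mult.assoc)
  show ?thesis
    using triple_product[of "fps_const c * fps_X" "fps_const c * fps_X", unfolded e]
    by (simp add: theta_term_square phi_def power2_eq_square[of "qpinf _ _"] mult.assoc fps_power_zeroth)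
qed

text \<open>The case x = q, y = 1 of the triple product. Summing over all integers meets each
  triangular number twice, at k and at -1 - k; on the product side the 2 comes from (-1; q) = 2(-q;
  q).\<close>

lemma psi_LIMSEQ:
  "(\<lambda>n. \<Sum>k=-int n..int n. fps_X ^ triangular k) \<longlonglongrightarrow> 2 * psi"
proof -
  have "qpinf (- 1) fps_X = 2 * qpinf (- fps_X :: int fps) fps_X"
    using qpinf_shift[of fps_X "- 1 :: int fps"] by simp
  then show ?thesis
    using triple_product[of "fps_X :: int fps" 1]
    by (simp add: theta_term_def psi_def power2_eq_square mult_ac)
qed

text \<open>The class 2 modulo 3 is written as -(3k + 1). The symmetry k -> -k of squares identifies
  it with the class of 3k + 1, the symmetry k -> -1 - k of triangular numbers with the class of
  3k.\<close>

lemma sum_third: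
  fixes f :: "int \<Rightarrow> 'a::comm_monoid_add"
  shows "(\<Sum>k=-int (3 * n + 1)..int (3 * n + 1). f k) =
    (\<Sum>k=-int n..int n. f (3 * k)) + (\<Sum>k=-int n..int n. f (3 * k + 1)) + (\<Sum>k=-int n..int n. f (- (3 * k + 1)))"
proof (induction n)
  case (Suc n)
  have "{-int (3 * Suc n + 1)..int (3 * Suc n + 1)} = {-int (3 * n + 1)..int (3 * n + 1)} \<union>
     {3 * int n + 2, 3 * int n + 3, 3 * int n + 4, - 2 - 3 * int n, -3 * int n - 3, - 4 - 3 * int n}"
    by auto
  moreover have "{-int (Suc n)..int (Suc n)} = {-int n..int n} \<union> {- int n - 1, int n + 1}" by auto
  ultimately show ?case
    using Suc by (simp add: algebra_simps)
next
  case 0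
  have "{-1..1::int} = {-1, 0, 1}" by auto
  then show ?case by (simp add: add_ac)
qed

text \<open>The 3-dissections are $\varphi(-q)=a(q^3)-2q\,b(q^3)$ and $\psi(q)=p(q^3)+q\,r(q^3)$ with
  \<open>phi_part0\<close>, \<open>phi_part1\<close>, \<open>psi_part0\<close>, \<open>psi_part1\<close> for $a,b,p,r$. The relation $pb=ra$ makes the
  three terms contributing to exponents $2$ modulo $3$ in $\psi(q)^2/\varphi(-q)$ proportional with
  weights $4+4+1=9$.\<close>

definition phi_part0 :: "int fps" where
  "phi_part0 = qpinf (fps_X ^ 3) (fps_X ^ 6) ^ 2 * qpinf (fps_X ^ 6) (fps_X ^ 6)"

definition phi_part1 :: "int fps" where
  "phi_part1 = qpinf (fps_X ^ 5) (fps_X ^ 6) * qpinf fps_X (fps_X ^ 6) * qpinf (fps_X ^ 6) (fps_X ^ 6)"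

definition psi_part0 :: "int fps" where
  "psi_part0 = qpinf (- (fps_X ^ 2)) (fps_X ^ 3) * qpinf (- fps_X) (fps_X ^ 3) * qpinf (fps_X ^ 3) (fps_X ^ 3)"

definition psi_part1 :: "int fps" where
  "psi_part1 = qpinf (- (fps_X ^ 3)) (fps_X ^ 3) ^ 2 * qpinf (fps_X ^ 3) (fps_X ^ 3)"

text \<open>Splitting (-q;q) and (q;q^2) into residue classes and applying Euler's identity to q and
  to q^3 shows that both sides equal (q^3;q^3)(q^6;q^6).\<close>

lemma theta_parts_relation: "psi_part0 * phi_part1 = psi_part1 * phi_part0"
proof -
  let ?A = "qpinf (- fps_X) (fps_X ^ 3) :: int fps" and ?B = "qpinf (- (fps_X ^ 2)) (fps_X ^ 3) :: int fps"
  let ?C = "qpinf (- (fps_X ^ 3)) (fps_X ^ 3) :: int fps"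
  let ?D = "qpinf fps_X (fps_X ^ 6) :: int fps" and ?E = "qpinf (fps_X ^ 3) (fps_X ^ 6) :: int fps"
  let ?F = "qpinf (fps_X ^ 5) (fps_X ^ 6) :: int fps"
  let ?f3 = "qpinf (fps_X ^ 3) (fps_X ^ 3) :: int fps" and ?f6 = "qpinf (fps_X ^ 6) (fps_X ^ 6) :: int fps"
  have 1: "qpinf (- fps_X) fps_X = ?A * ?B * ?C"
    using qpinf_split_3[of "fps_X :: int fps" "- fps_X"] by (simp add: numeral_eq_Suc)
  have 2: "qpinf fps_X (fps_X ^ 2) = ?D * ?E * ?F"
  proof -
    have p: "(fps_X ^ 2) ^ 3 = (fps_X ^ 6 :: int fps)" "fps_X * fps_X ^ 2 = (fps_X ^ 3 :: int fps)"
      "fps_X * (fps_X ^ 2) ^ 2 = (fps_X ^ 5 :: int fps)"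
      by (simp_all add: numeral_eq_Suc)
    show ?thesis using qpinf_split_3[of "fps_X ^ 2 :: int fps" fps_X] unfolding p by simp
  qed
  have 3: "(?D * ?E * ?F) * (?A * ?B * ?C) = 1"
    using qpinf_Euler[of "fps_X :: int fps"] unfolding 1 2 by simp
  have 4: "?E * ?C = 1"
    using qpinf_Euler[of "fps_X ^ 3 :: int fps"] by (simp flip: power_mult)
  have "psi_part0 * phi_part1 = (?A * ?B * ?D * ?F) * (?E * ?C) * ?f3 * ?f6"
    unfolding 4 psi_part0_def phi_part1_def by (simp only: mult_ac mult_1)
  also have "\<dots> = ((?D * ?E * ?F) * (?A * ?B * ?C)) * ?f3 * ?f6"
    by (simp only: mult_ac)
  also have "\<dots> = (?E * ?C) * (?E * ?C) * ?f3 * ?f6"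
    unfolding 3 4 by simp
  also have "\<dots> = psi_part1 * phi_part0"
    unfolding psi_part1_def phi_part0_def power2_eq_square[of ?E] power2_eq_square[of ?C] by (simp only: mult_ac)
  finally show ?thesis .
qed

lemma strict_mono_third: "strict_mono (\<lambda>n::nat. 3 * n + 1)"
  by (simp add: strict_mono_def)

text \<open>Multiples of 3 contribute the exponents 9k^2. The other two classes coincide, whence the
  2, and (3k + 1)^2 = 1 + 15 k(k+1)/2 + 3 k(k-1)/2 makes them a theta series again.\<close>

lemma phi_minus_dissection:
  "phi (- 1) = (phi_part0 oo fps_X ^ 3) - 2 * fps_X * (phi_part1 oo fps_X ^ 3)"
proof (rule LIMSEQ_unique)
  let ?f = "\<lambda>k. (- fps_X :: int fps) ^ nat (k\<^sup>2)"
  have "(\<lambda>n. \<Sum>k=-int n..int n. ?f k) \<longlonglongrightarrow> phi (- 1)"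
    using phi_LIMSEQ[of "-1"] by (simp flip: fps_const_neg)
  then show "(\<lambda>n. \<Sum>k=-int (3 * n + 1)..int (3 * n + 1). ?f k) \<longlonglongrightarrow> phi (- 1)"
    using LIMSEQ_subseq_LIMSEQ[OF _ strict_mono_third, of "\<lambda>n. \<Sum>k=-int n..int n. ?f k"]
    by (simp add: o_def)
  have t0: "?f (3 * k) = theta_term (- (fps_X ^ 9)) (- (fps_X ^ 9)) k" for k
  proof -
    have "nat ((3 * k)\<^sup>2) = 9 * nat (k\<^sup>2)" by (simp add: power_mult_distrib nat_mult_distrib)
    then show ?thesis by (simp add: theta_term_square power_mult)
  qed
  have t1: "?f (3 * k + 1) = - fps_X * theta_term (- (fps_X ^ 15)) (- (fps_X ^ 3)) k" for k
  proof -
    have "nat ((3 * k + 1)\<^sup>2) = Suc (15 * triangular k + 3 * triangular (k - 1))"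
      using triangular[of k] triangular[of "k - 1"] by (simp add: algebra_simps power2_eq_square nat_eq_iff)
    then show ?thesis by (simp add: theta_term_def power_add power_mult)
  qed
  have t2: "?f (- (3 * k + 1)) = ?f (3 * k + 1)" for k
    by (simp only: power2_minus)
  have 0: "(\<lambda>n. \<Sum>k=-int n..int n. theta_term (- (fps_X ^ 9)) (- (fps_X ^ 9)) k) \<longlonglongrightarrow> (phi_part0 oo fps_X ^ 3)"
    using triple_product[of "- (fps_X ^ 9) :: int fps" "- (fps_X ^ 9)"]
    by (simp add: phi_part0_def fps_compose_mult_distrib qpinf_compose power2_eq_square mult.assoc
      flip: fps_compose_power power_mult power_add)
  have 1: "(\<lambda>n. \<Sum>k=-int n..int n. theta_term (- (fps_X ^ 15)) (- (fps_X ^ 3)) k) \<longlonglongrightarrow> (phi_part1 oo fps_X ^ 3)"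
    using triple_product[of "- (fps_X ^ 15) :: int fps" "- (fps_X ^ 3)"]
    by (simp add: phi_part1_def fps_compose_mult_distrib qpinf_compose
      flip: fps_compose_power power_mult power_add)
  have "(\<Sum>k=-int (3 * n + 1)..int (3 * n + 1). ?f k)
      = (\<Sum>k=-int n..int n. theta_term (- (fps_X ^ 9)) (- (fps_X ^ 9)) k)
       - 2 * fps_X * (\<Sum>k=-int n..int n. theta_term (- (fps_X ^ 15)) (- (fps_X ^ 3)) k)" for n
    unfolding sum_third t2 unfolding t0 t1 by (simp add: sum_distrib_left[symmetric] sum_negf)
  then show "(\<lambda>n. \<Sum>k=-int (3 * n + 1)..int (3 * n + 1). ?f k) \<longlonglongrightarrow>
      (phi_part0 oo fps_X ^ 3) - 2 * fps_X * (phi_part1 oo fps_X ^ 3)"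
    using tendsto_fps_diff[OF 0 tendsto_fps_mult[OF tendsto_const 1]] by simp
qed

text \<open>Under k -> -1 - k the classes 0 and 2 modulo 3 are exchanged and the class 1 is mapped
  to itself, so both parts carry a factor 2, cancelled at the end.\<close>

lemma psi_dissection: "psi = (psi_part0 oo fps_X ^ 3) + fps_X * (psi_part1 oo fps_X ^ 3)"
proof -
  let ?f = "\<lambda>k. fps_X ^ triangular k :: int fps"
  have lim: "(\<lambda>n. \<Sum>k=-int (3 * n + 1)..int (3 * n + 1). ?f k) \<longlonglongrightarrow> 2 * psi"
    using LIMSEQ_subseq_LIMSEQ[OF psi_LIMSEQ strict_mono_third] by (simp add: o_def)
  have t0: "?f (3 * k) = theta_term (fps_X ^ 6) (fps_X ^ 3) k" for k
  proof -
    have "triangular (3 * k) = 6 * triangular k + 3 * triangular (k - 1)"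
      using triangular[of k] triangular[of "k - 1"] triangular[of "3 * k"] by (simp add: algebra_simps)
    then show ?thesis by (simp add: theta_term_def power_add power_mult)
  qed
  have t1: "?f (3 * k + 1) = fps_X * theta_term (fps_X ^ 9) 1 k" for k
  proof -
    have "triangular (3 * k + 1) = Suc (9 * triangular k)"
      using triangular[of k] triangular[of "3 * k + 1"] by (simp add: algebra_simps)
    then show ?thesis by (simp add: theta_term_def power_mult)
  qed
  have t2: "?f (- (3 * k + 1)) = ?f (3 * k)" for k
  proof -
    have "triangular (- (3 * k + 1)) = triangular (3 * k)"
      using triangular[of "- (3 * k + 1)"] triangular[of "3 * k"] by (simp add: algebra_simps)
    then show ?thesis by simp
  qed
  have "qpinf (- 1) (fps_X ^ 9) = 2 * qpinf (- (fps_X ^ 9) :: int fps) (fps_X ^ 9)"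
    using qpinf_shift[of "fps_X ^ 9" "- 1 :: int fps"] by simp
  then have 1: "(\<lambda>n. \<Sum>k=-int n..int n. theta_term (fps_X ^ 9) 1 k) \<longlonglongrightarrow> 2 * (psi_part1 oo fps_X ^ 3)"
    using triple_product[of "fps_X ^ 9 :: int fps" 1]
    by (simp add: psi_part1_def fps_compose_mult_distrib qpinf_compose power2_eq_square mult_ac fps_compose_uminus
      flip: fps_compose_power power_mult power_add)
  have 0: "(\<lambda>n. \<Sum>k=-int n..int n. theta_term (fps_X ^ 6) (fps_X ^ 3) k) \<longlonglongrightarrow> (psi_part0 oo fps_X ^ 3)"
    using triple_product[of "fps_X ^ 6 :: int fps" "fps_X ^ 3"]
    by (simp add: psi_part0_def fps_compose_mult_distrib qpinf_compose fps_compose_uminus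
      flip: fps_compose_power power_mult power_add)
  have "(\<Sum>k=-int (3 * n + 1)..int (3 * n + 1). ?f k)
      = 2 * (\<Sum>k=-int n..int n. theta_term (fps_X ^ 6) (fps_X ^ 3) k)
       + fps_X * (\<Sum>k=-int n..int n. theta_term (fps_X ^ 9) 1 k)" for n
    unfolding sum_third t2 unfolding t0 t1 by (simp add: sum_distrib_left[symmetric])
  then have "(\<lambda>n. \<Sum>k=-int (3 * n + 1)..int (3 * n + 1). ?f k) \<longlonglongrightarrow>
      2 * (psi_part0 oo fps_X ^ 3) + fps_X * (2 * (psi_part1 oo fps_X ^ 3))"
    using tendsto_fps_add[OF tendsto_fps_mult[OF tendsto_const 0] tendsto_fps_mult[OF tendsto_const 1]] by simp
  with lim have "2 * psi = 2 * (psi_part0 oo fps_X ^ 3) + fps_X * (2 * (psi_part1 oo fps_X ^ 3))"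
    by (rule LIMSEQ_unique)
  also have "\<dots> = 2 * ((psi_part0 oo fps_X ^ 3) + fps_X * (psi_part1 oo fps_X ^ 3))"
    by (simp only: distrib_left mult_ac)
  finally show ?thesis by (subst (asm) mult_left_cancel) simp_all
qed

lemma B_even_phi_psi: "B_even * phi (- 1) = psi ^ 2"
proof -
  have e: "qpinf (fps_X ^ 2) (fps_X ^ 2) = qpinf fps_X fps_X * qpinf (- fps_X :: int fps) fps_X"
    using qpinf_mult_uminus[of "fps_X :: int fps" fps_X] by simp
  have "B_even * phi (- 1) = B_even * qpinf fps_X (fps_X ^ 2) ^ 2 * qpinf (fps_X ^ 2) (fps_X ^ 2)"
    by (simp add: phi_def mult.assoc flip: fps_const_neg)
  also have "\<dots> = psi ^ 2"
    unfolding B_even_product unfolding e psi_def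
    by (simp add: power3_eq_cube power2_eq_square mult_ac)
  finally show ?thesis .
qed

lemma B_even_mod_9: "9 dvd B_even $ (3 * n + 2)"
proof -
  \<comment> \<open>The denominator a^2(a^3 - 8q b^3) that remains after rationalisation, before q
    is replaced by q^3.\<close>
  define H where "H = phi_part0 ^ 2 * (phi_part0 ^ 3 - 8 * fps_X * phi_part1 ^ 3)"
  define K where "K = fps_right_inverse H 1"
  have "H $ 0 = 1" by (simp add: H_def phi_part0_def fps_power_zeroth qpinf_nth_0)
  then have HK: "H * K = 1" unfolding K_def by (rule fps_unit_inverse)
  let ?c = "\<lambda>f. f oo fps_X ^ 3 :: int fps"
  define u where "u = fps_X * ?c phi_part1"
  have rel: "?c psi_part0 * ?c phi_part1 = ?c psi_part1 * ?c phi_part0"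
    using arg_cong[OF theta_parts_relation, of ?c] by (simp add: fps_compose_mult_distrib)
  have "B_even * (?c phi_part0 - 2 * u) = (?c psi_part0 + fps_X * ?c psi_part1) ^ 2"
    using B_even_phi_psi unfolding phi_minus_dissection psi_dissection u_def by (simp only: mult.assoc)
  \<comment> \<open>The extra factor a(q^3)^2 allows \<open>rel\<close> to replace ra by pb, so that
    p(q^3)^2 splits off the numerator.\<close>
  then have "B_even * (?c phi_part0 - 2 * u) * ?c phi_part0 ^ 2 = (?c psi_part0 * ?c phi_part0 + fps_X * (?c psi_part1 * ?c phi_part0)) ^ 2"
    by (simp add: power2_eq_square algebra_simps)
  also have "\<dots> = ?c psi_part0 ^ 2 * (?c phi_part0 + u) ^ 2"
    unfolding rel[symmetric] u_def by (simp add: power2_eq_square algebra_simps)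
  \<comment> \<open>The new factor completes x - 2u to x^3 - 8u^3, where x = a(q^3). Since u is q
    times a series in q^3, this is a series in q^3.\<close>
  finally have "B_even * (?c phi_part0 - 2 * u) * ?c phi_part0 ^ 2 * (?c phi_part0 ^ 2 + 2 * ?c phi_part0 * u + 4 * u ^ 2)
     = ?c psi_part0 ^ 2 * (?c phi_part0 + u) ^ 2 * (?c phi_part0 ^ 2 + 2 * ?c phi_part0 * u + 4 * u ^ 2)" by simp
  moreover have "B_even * (x - 2 * u) * x ^ 2 * (x ^ 2 + 2 * x * u + 4 * u ^ 2)
      = B_even * (x ^ 2 * (x ^ 3 - 8 * u ^ 3))" for x
    by (simp add: power2_eq_square power3_eq_cube algebra_simps)
  \<comment> \<open>The expansion is sorted by the exponent of u modulo 3, hence by the exponent of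
    q modulo 3. The class 2 consists of x^2 u^2 alone, with coefficient 9.\<close>
  moreover have "p ^ 2 * (x + u) ^ 2 * (x ^ 2 + 2 * x * u + 4 * u ^ 2)
      = p ^ 2 * (x ^ 4 + 10 * x * u ^ 3) + p ^ 2 * (4 * x ^ 3 * u + 4 * u ^ 4) + 9 * (p ^ 2 * x ^ 2 * u ^ 2)" for x p
    by (simp add: power2_eq_square power3_eq_cube power4_eq_xxxx algebra_simps)
  ultimately have "B_even * (?c phi_part0 ^ 2 * (?c phi_part0 ^ 3 - 8 * u ^ 3))
     = ?c psi_part0 ^ 2 * (?c phi_part0 ^ 4 + 10 * ?c phi_part0 * u ^ 3)
       + ?c psi_part0 ^ 2 * (4 * ?c phi_part0 ^ 3 * u + 4 * u ^ 4) + 9 * (?c psi_part0 ^ 2 * ?c phi_part0 ^ 2 * u ^ 2)"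
    by simp
  moreover have "?c phi_part0 ^ 2 * (?c phi_part0 ^ 3 - 8 * u ^ 3) = ?c H"
    unfolding H_def u_def
    by (simp add: fps_compose_mult_distrib fps_compose_sub_distrib power_mult_distrib mult_ac flip: fps_compose_power)
  moreover have "?c psi_part0 ^ 2 * (?c phi_part0 ^ 4 + 10 * ?c phi_part0 * u ^ 3)
      = ?c (psi_part0 ^ 2 * (phi_part0 ^ 4 + 10 * phi_part0 * fps_X * phi_part1 ^ 3))"
    unfolding u_def
    by (simp add: fps_compose_mult_distrib fps_compose_add_distrib power_mult_distrib mult_ac flip: fps_compose_power)
  moreover have "?c psi_part0 ^ 2 * (4 * ?c phi_part0 ^ 3 * u + 4 * u ^ 4)
      = fps_X * ?c (psi_part0 ^ 2 * (4 * phi_part0 ^ 3 * phi_part1 + 4 * fps_X * phi_part1 ^ 4))"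
    unfolding u_def
    by (simp add: fps_compose_mult_distrib fps_compose_add_distrib power_mult_distrib algebra_simps 
        power_numeral_reduce flip: fps_compose_power)
  moreover have "?c psi_part0 ^ 2 * ?c phi_part0 ^ 2 * u ^ 2 = fps_X ^ 2 * ?c (psi_part0 ^ 2 * phi_part0 ^ 2 * phi_part1 ^ 2)"
    unfolding u_def
    by (simp add: fps_compose_mult_distrib power_mult_distrib mult_ac flip: fps_compose_power)
  ultimately obtain F0 F1 F2 where F: "B_even * ?c H = ?c F0 + fps_X * ?c F1 + 9 * (fps_X ^ 2 * ?c F2)"
    by metis
  have "B_even * (?c H * ?c K) = B_even * ?c H * ?c K" by (simp only: mult.assoc)
  also have "\<dots> = ?c F0 * ?c K + fps_X * (?c F1 * ?c K) + 9 * (fps_X ^ 2 * (?c F2 * ?c K))"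
    unfolding F by (simp only: distrib_right mult.assoc)
  finally have "B_even * (?c H * ?c K) = \<dots>" .
  moreover have "?c H * ?c K = 1"
    using arg_cong[OF HK, of ?c] by (simp add: fps_compose_mult_distrib)
  ultimately have "B_even = ?c (F0 * K) + fps_X * ?c (F1 * K) + 9 * (fps_X ^ 2 * ?c (F2 * K))" (is "_ = ?F")
    by (simp add: fps_compose_mult_distrib)
  then have "B_even $ (3 * n + 2) = ?F $ (3 * n + 2)" by (rule arg_cong)
  moreover have "\<not> 3 dvd 3 * n + 2" "\<not> 3 dvd 3 * n + 1" by presburger+
  then have "?c (F0 * K) $ (3 * n + 2) = 0" "(fps_X * ?c (F1 * K)) $ (3 * n + 2) = 0"
    by (simp_all add: fps_nth_compose_X_power)
  ultimately have "B_even $ (3 * n + 2) = (9 * (fps_X ^ 2 * ?c (F2 * K))) $ (3 * n + 2)"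
    by (simp only: fps_add_nth add_0)
  then show ?thesis
    by (simp add: numeral_fps_const)
qed

section \<open>The congruence modulo 8\<close>

lemma phi_nth:
  assumes "c ^ 2 = 1"
  shows "phi c $ i = (if i = 0 then 1 else if \<exists>m. i = m ^ 2 then 2 * c ^ i else 0)"
proof -
  have "eventually (\<lambda>n. (\<Sum>k=-int n..int n. (fps_const c * fps_X) ^ nat (k\<^sup>2)) $ i = phi c $ i) sequentially"
    using phi_LIMSEQ[OF assms] unfolding tendsto_fps_iff by blast
  then obtain n where n: "n \<ge> i" "(\<Sum>k=-int n..int n. (fps_const c * fps_X) ^ nat (k\<^sup>2)) $ i = phi c $ i"
    using eventually_happens'[OF sequentially_bot eventually_conj[OF eventually_ge_at_top[of i]]] by blast
  have "phi c $ i = (\<Sum>k=-int n..int n. if nat (k\<^sup>2) = i then c ^ i else 0)"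
    unfolding n(2)[symmetric] fps_sum_nth
    by (intro sum.cong refl) (auto simp: power_mult_distrib fps_const_power fps_X_power_nth)
  also have "\<dots> = int (card {k \<in> {-int n..int n}. nat (k\<^sup>2) = i}) * c ^ i"
    by (simp add: sum.inter_filter[symmetric])
  also have "\<dots> = (if i = 0 then 1 else if \<exists>m. i = m ^ 2 then 2 * c ^ i else 0)"
  proof (cases "\<exists>m. i = m ^ 2")
    case True
    then obtain m where m: "i = m ^ 2" ..
    have "m \<le> n" using n(1) m by (metis power2_nat_le_imp_le)
    have "nat (k\<^sup>2) = i \<longleftrightarrow> k = int m \<or> k = - int m" for k
      by (simp add: m nat_eq_iff power2_eq_iff)
    then have "{k \<in> {-int n..int n}. nat (k\<^sup>2) = i} = {int m, - int m}"
      using \<open>m \<le> n\<close> by auto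
    then show ?thesis using m by auto
  next
    case False
    have "nat (k\<^sup>2) \<noteq> i" for k
      using False by (metis nat_abs_mult_distrib power2_abs nat_power_eq abs_ge_zero)
    moreover have "i \<noteq> 0" using False by (metis zero_power2)
    ultimately show ?thesis using False by simp
  qed
  finally show ?thesis .
qed

lemma psi_nth: "psi $ i = (if \<exists>j. 2 * i = j * (j + 1) then 1 else 0)"
proof -
  have "eventually (\<lambda>n. (\<Sum>k=-int n..int n. fps_X ^ triangular k) $ i = (2 * psi) $ i) sequentially"
    using psi_LIMSEQ unfolding tendsto_fps_iff by blast
  \<comment> \<open>A solution j of j(j + 1) = 2i satisfies j <= 2i, and the window has to contain
    -j - 1 as well.\<close>
  then obtain n where n: "n \<ge> 2 * i + 1" "(\<Sum>k=-int n..int n. fps_X ^ triangular k) $ i = (2 * psi) $ i"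
    using eventually_happens'[OF sequentially_bot eventually_conj[OF eventually_ge_at_top[of "2 * i + 1"]]] by blast
  have "2 * psi $ i = (2 * psi) $ i" by (simp only: mult_2 fps_add_nth)
  also have "\<dots> = (\<Sum>k=-int n..int n. if triangular k = i then 1 else 0)"
    unfolding n(2)[symmetric] fps_sum_nth by (intro sum.cong refl) (auto simp: fps_X_power_nth)
  also have "\<dots> = int (card {k \<in> {-int n..int n}. triangular k = i})"
    by (simp add: sum.inter_filter[symmetric])
  also have "{k \<in> {-int n..int n}. triangular k = i} = {k \<in> {-int n..int n}. k * (k + 1) = 2 * int i}"
    by (simp flip: triangular)
  also have "int (card \<dots>) = 2 * (if \<exists>j. 2 * i = j * (j + 1) then 1 else 0)"
  proof (cases "\<exists>j. 2 * i = j * (j + 1)")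
    case True
    then obtain j where j: "2 * i = j * (j + 1)" ..
    then have j': "2 * int i = int j * (int j + 1)" by (metis of_nat_1 of_nat_add of_nat_mult of_nat_numeral)
    have "j \<le> 2 * i" unfolding j by simp
    have "k * (k + 1) = 2 * int i \<longleftrightarrow> (k - int j) * (k + int j + 1) = 0" for k
      unfolding j' by (simp add: algebra_simps)
    then have "k * (k + 1) = 2 * int i \<longleftrightarrow> k = int j \<or> k = - int j - 1" for k
      unfolding mult_eq_0_iff by (simp only:) linarith
    then have "{k \<in> {-int n..int n}. k * (k + 1) = 2 * int i} = {int j, - int j - 1}"
      using n(1) \<open>j \<le> 2 * i\<close> by auto
    then show ?thesis using True by simp
  next
    case False
    have "k * (k + 1) \<noteq> 2 * int i" for k
    proof
      assume k: "k * (k + 1) = 2 * int i"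
      define j where "j = nat (if k \<ge> 0 then k else - k - 1)"
      have "int (2 * i) = int (j * (j + 1))" using k by (auto simp: j_def algebra_simps)
      then show False using False by (metis of_nat_eq_iff)
    qed
    then show ?thesis using False by simp
  qed
  finally show ?thesis by (simp split: if_splits)
qed

definition odd_squares :: "int fps" where
  "odd_squares = Abs_fps (\<lambda>i. if odd i \<and> (\<exists>m. i = m ^ 2) then 1 else 0)"

lemma psi_sq_nth: "(psi oo fps_X ^ 2) $ i = (if \<exists>j. i = j * (j + 1) then 1 else 0)"
proof (cases "even i")
  case True
  then obtain l where "i = 2 * l" ..
  then show ?thesis by (simp add: fps_nth_compose_X_power psi_nth)
next
  case False
  then have "i \<noteq> j * (j + 1)" for j by auto
  then show ?thesis using False by (simp add: fps_nth_compose_X_power)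
qed

lemma phi_1_eq: "phi 1 = phi (- 1) + 4 * odd_squares"
proof (rule fps_ext)
  fix i
  have "(4 * odd_squares) $ i = 4 * odd_squares $ i" by (simp add: numeral_fps_const)
  then show "phi 1 $ i = (phi (- 1) + 4 * odd_squares) $ i"
    by (simp add: phi_nth odd_squares_def)
qed

lemma phi_minus_1_mod_2: "2 dvd phi (- 1) - 1"
proof -
  have "fps_const 2 dvd phi (- 1) - 1"
    unfolding int_fps_dvd_iff by (auto simp: phi_nth)
  then show ?thesis by (simp add: numeral_fps_const)
qed

lemma psi_square: "psi ^ 2 = phi 1 * (psi oo fps_X ^ 2)"
proof -
  have 1: "qpinf (fps_X ^ 2) (fps_X ^ 2) = qpinf fps_X fps_X * qpinf (- fps_X :: int fps) fps_X"
    using qpinf_mult_uminus[of "fps_X :: int fps" fps_X] by simp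
  have 2: "qpinf (- fps_X :: int fps) fps_X = qpinf (- fps_X) (fps_X ^ 2) * qpinf (- (fps_X ^ 2)) (fps_X ^ 2)"
    using qpinf_split_2[of "fps_X :: int fps" "- fps_X"] by (simp add: power2_eq_square)
  have "psi oo fps_X ^ 2 = qpinf (- (fps_X ^ 2)) (fps_X ^ 2) ^ 2 * qpinf (fps_X ^ 2) (fps_X ^ 2)"
    unfolding psi_def by (simp add: fps_compose_mult_distrib qpinf_compose fps_compose_uminus flip: fps_compose_power)
  then have "phi 1 * (psi oo fps_X ^ 2)
     = (qpinf (- fps_X) (fps_X ^ 2) * qpinf (- (fps_X ^ 2)) (fps_X ^ 2)) ^ 2 * qpinf (fps_X ^ 2) (fps_X ^ 2) ^ 2"
    by (simp add: phi_def power2_eq_square mult_ac)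
  then show ?thesis
    unfolding 2[symmetric] 1 psi_def by (simp add: power2_eq_square mult_ac)
qed

text \<open>With S = \<open>odd_squares\<close>, E(q) phi(-q) = psi(q^2)(phi(-q) + 4S). The
  difference times phi(-q) is therefore 4 S psi(q^2)(1 - phi(-q)), and phi(-q) is an invertible
  series congruent to 1 modulo 2.\<close>

lemma B_even_mod_8:
  "8 dvd B_even - (psi oo fps_X ^ 2) - 4 * (odd_squares * (psi oo fps_X ^ 2))"
proof -
  let ?p = "psi oo fps_X ^ 2" and ?f = "phi (- 1)"
  obtain T where T: "?f - 1 = 2 * T" using phi_minus_1_mod_2 by (elim dvdE)
  have "(B_even - ?p - 4 * (odd_squares * ?p)) * ?f = B_even * ?f - ?p * ?f - 4 * odd_squares * ?p * ?f"
    by (simp add: algebra_simps)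
  also have "\<dots> = - (4 * odd_squares * ?p) * (?f - 1)"
    unfolding B_even_phi_psi psi_square phi_1_eq by (simp add: algebra_simps)
  also have "\<dots> = 8 * (- (odd_squares * ?p * T))" unfolding T by simp
  finally have "8 dvd (B_even - ?p - 4 * (odd_squares * ?p)) * ?f" by simp
  moreover have "?f * fps_right_inverse ?f 1 = 1"
    by (rule fps_unit_inverse) (simp add: phi_nth)
  then have "B_even - ?p - 4 * (odd_squares * ?p)
     = (B_even - ?p - 4 * (odd_squares * ?p)) * ?f * fps_right_inverse ?f 1"
    by (simp only: mult.assoc mult_1_right)
  ultimately show ?thesis by (metis dvd_mult2)
qed

text \<open>The nonsquare hypothesis kills the coefficient of psi(q^2) at n. An odd square y^2 with
  n - y^2 = j(j + 1) corresponds to the representation (2j + 1)^2 + 4y^2 = 4n + 1.\<close>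

lemma b_even_mod_8:
  assumes "\<not> is_square (4 * n + 1)"
  shows "[b (2 * n) = 4 * int (card {(x, y). x ^ 2 + 4 * y ^ 2 = 4 * n + 1 \<and> odd y})] (mod 8)"
proof -
  let ?p = "psi oo fps_X ^ 2"
  let ?S = "{(x, y). x ^ 2 + 4 * y ^ 2 = 4 * n + 1 \<and> odd y}"
  let ?I = "{i \<in> {0..n}. odd i \<and> (\<exists>m. i = m ^ 2) \<and> (\<exists>j. n - i = j * (j + 1))}"
  have "n \<noteq> j * (j + 1)" for j
  proof
    assume "n = j * (j + 1)"
    then have "4 * n + 1 = (2 * j + 1) ^ 2" by (simp add: power2_eq_square algebra_simps)
    then show False using assms by (metis is_nth_power_nth_power)
  qed
  then have p: "?p $ n = 0" by (simp add: psi_sq_nth)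
  have "(odd_squares * ?p) $ n = (\<Sum>i=0..n. if odd i \<and> (\<exists>m. i = m ^ 2) \<and> (\<exists>j. n - i = j * (j + 1)) then 1 else 0)"
    unfolding fps_mult_nth by (intro sum.cong refl) (auto simp: odd_squares_def psi_sq_nth)
  also have "\<dots> = int (card ?I)"
    by (simp add: sum.inter_filter[symmetric])
  also have "card ?I = card ?S"
  proof (rule sym, rule bij_betw_same_card[of "\<lambda>(x, y). y ^ 2"], rule bij_betw_imageI)
    show "inj_on (\<lambda>(x, y). y ^ 2) ?S"
    proof (rule inj_onI, clarify)
      fix x y x' y' :: nat
      assume "x\<^sup>2 + 4 * y\<^sup>2 = 4 * n + 1" "x'\<^sup>2 + 4 * y'\<^sup>2 = 4 * n + 1" "y\<^sup>2 = y'\<^sup>2"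
      then have "x\<^sup>2 = x'\<^sup>2" by linarith
      with \<open>y\<^sup>2 = y'\<^sup>2\<close> show "x = x' \<and> y = y'" by simp
    qed
    show "(\<lambda>(x, y). y ^ 2) ` ?S = ?I"
    proof (intro equalityI subsetI)
      fix i assume "i \<in> (\<lambda>(x, y). y ^ 2) ` ?S"
      then obtain x y where xy: "x ^ 2 + 4 * y ^ 2 = 4 * n + 1" "odd y" "i = y ^ 2" by auto
      have "odd x" using arg_cong[OF xy(1), of even] by simp
      then obtain j where "x = 2 * j + 1" by (elim oddE)
      then have "n = j * (j + 1) + y ^ 2" using xy(1) by (simp add: power2_eq_square algebra_simps)
      then show "i \<in> ?I" using xy by auto
    next
      fix i assume "i \<in> ?I"
      then obtain y j where "i = y ^ 2" "odd i" "n - i = j * (j + 1)" "i \<le> n" by auto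
      then have "(2 * j + 1, y) \<in> ?S" by (simp add: power2_eq_square algebra_simps)
      then show "i \<in> (\<lambda>(x, y). y ^ 2) ` ?S" using \<open>i = y ^ 2\<close> by force
    qed
  qed
  finally have c: "(odd_squares * ?p) $ n = int (card ?S)" .
  have "8 dvd (B_even - ?p - 4 * (odd_squares * ?p)) $ n"
    using B_even_mod_8 by (simp add: numeral_fps_const int_fps_dvd_iff)
  moreover have "(B_even - ?p - 4 * (odd_squares * ?p)) $ n = b (2 * n) - 4 * int (card ?S)"
    unfolding fps_sub_nth p numeral_fps_const fps_mult_left_const_nth c by (simp add: B_even_def)
  ultimately show ?thesis by (simp add: cong_iff_dvd_diff)
qed

section \<open>Counting representations by $x^2+4y^2$ modulo 2\<close>

lemma even_card_involution:
  assumes "finite S" "\<And>x. x \<in> S \<Longrightarrow> f x \<in> S" "\<And>x. x \<in> S \<Longrightarrow> f (f x) = x"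
  shows "even (card S) \<longleftrightarrow> even (card {x \<in> S. f x = x})"
  using assms
proof (induction "card S" arbitrary: S rule: less_induct)
  case less
  show ?case
  proof (cases "\<exists>x\<in>S. f x \<noteq> x")
    case True
    then obtain x where x: "x \<in> S" "f x \<noteq> x" by blast
    let ?T = "S - {x, f x}"
    have fx: "f x \<in> S" "f (f x) = x" using less.prems x by auto
    have "card ?T = card S - 2" "card S \<ge> 2"
      using x fx less.prems(1) by (auto simp: card_Diff_subset card_le_Suc_iff)
       (metis card_2_iff card_mono empty_subsetI insert_subset)
    moreover have "even (card ?T) \<longleftrightarrow> even (card {y \<in> ?T. f y = y})"
    proof (rule less.hyps)
      show "card ?T < card S" using x less.prems(1) by (intro psubset_card_mono) auto
      fix y assume y: "y \<in> ?T"
      then show ffy: "f (f y) = y" using less.prems by auto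
      have "f y \<noteq> x" "f y \<noteq> f x" using y ffy fx by auto
      then show "f y \<in> ?T" using y less.prems by auto
    qed (use less.prems in auto)
    moreover have "{y \<in> ?T. f y = y} = {y \<in> S. f y = y}" using x fx by auto
    ultimately show ?thesis by (simp add: even_diff_nat)
  next
    case False
    then have "{x \<in> S. f x = x} = S" by auto
    then show ?thesis by simp
  qed
qed

text \<open>The number of solutions of $x^2+4yz=m$ is computed modulo 2 in two ways: swapping $y$ and $z$
  has the representations $m=x^2+(2y)^2$ as fixed points, while Zagier's involution fixes
  exactly the solutions with $x=y$, which are the factorizations $m=x(x+4z)$.\<close>

definition zagier_set :: "nat \<Rightarrow> (int \<times> int \<times> int) set" where
  "zagier_set m = {(x, y, z). x > 0 \<and> y > 0 \<and> z > 0 \<and> x * x + 4 * y * z = int m}"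

text \<open>The first and third branches are inverse to each other, and the middle one is its own
  inverse. Ties between the branches are excluded by \<open>zagier_boundary\<close>.\<close>

definition zagier :: "int \<times> int \<times> int \<Rightarrow> int \<times> int \<times> int" where
  "zagier = (\<lambda>(x, y, z). if x < y - z then (x + 2 * z, z, y - x - z)
     else if x < 2 * y then (2 * y - x, y, x - y + z)
     else (x - 2 * y, x - y + z, y))"

lemma finite_zagier_set: "finite (zagier_set m)"
proof (rule finite_subset)
  show "zagier_set m \<subseteq> {1..int m} \<times> {1..int m} \<times> {1..int m}"
  proof
    fix t assume "t \<in> zagier_set m"
    then obtain x y z where t: "t = (x, y, z)"
      and *: "x > 0" "y > 0" "z > 0" "x * x + 4 * (y * z) = int m"
      by (auto simp: zagier_set_def)
    have "x * 1 \<le> x * x" "y * 1 \<le> y * z" "1 * z \<le> y * z" "0 < x * x" "0 < y * z"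
      using * by (intro mult_left_mono mult_right_mono mult_pos_pos; simp)+
    then have "1 \<le> x \<and> x \<le> int m \<and> 1 \<le> y \<and> y \<le> int m \<and> 1 \<le> z \<and> z \<le> int m"
      using * by linarith
    then show "t \<in> {1..int m} \<times> {1..int m} \<times> {1..int m}" using t by simp
  qed
qed simp

text \<open>On the walls between the branches of \<open>zagier\<close>, m would be (y + z)^2 or
  even.\<close>

lemma zagier_boundary:
  assumes "odd m" "\<not> is_square m" "(x, y, z) \<in> zagier_set m"
  shows "x \<noteq> y - z" "x \<noteq> 2 * y"
proof -
  have *: "x * x + 4 * y * z = int m" "y > 0" "z > 0" using assms by (auto simp: zagier_set_def)
  show "x \<noteq> y - z"
  proof
    assume "x = y - z"
    then have "int m = (y + z) ^ 2" unfolding *(1)[symmetric] \<open>x = y - z\<close> by (simp add: power2_eq_square algebra_simps)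
    then have "m = nat (y + z) ^ 2" using * by (simp add: nat_power_eq[symmetric]) 
    then show False using assms(2) by (metis is_nth_power_nth_power)
  qed
  show "x \<noteq> 2 * y"
  proof
    assume "x = 2 * y"
    then have "int m = 2 * (2 * y * y + 2 * y * z)" using * by simp
    then have "even (int m)" by (metis dvd_triv_left)
    then show False using assms(1) by simp
  qed
qed

lemma zagier_involution:
  assumes "odd m" "\<not> is_square m" "t \<in> zagier_set m"
  shows "zagier t \<in> zagier_set m" "zagier (zagier t) = t"
proof -
  obtain x y z where t: "t = (x, y, z)" by (cases t)
  note b = zagier_boundary[OF assms(1,2), of x y z]
  have *: "x > 0" "y > 0" "z > 0" "x * x + 4 * y * z = int m" "x \<noteq> y - z" "x \<noteq> 2 * y"
    using assms b by (auto simp: t zagier_set_def)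
  then show "zagier t \<in> zagier_set m" "zagier (zagier t) = t"
    by (auto simp: t zagier_set_def zagier_def algebra_simps)
qed

lemma card_two_squares_parity:
  fixes m :: nat
  assumes "m mod 4 = 1" "\<not> is_square m"
  shows "even (card {(x, y). x ^ 2 + 4 * y ^ 2 = m}) \<longleftrightarrow> even (card {d. d dvd m \<and> d * d < m})"
proof -
  let ?S = "zagier_set m" and ?f = "\<lambda>(x :: int, y :: int, z :: int). (x, z, y)"
  have odd: "odd m" using assms(1) by presburger
  have "even (card ?S) \<longleftrightarrow> even (card {t \<in> ?S. ?f t = t})"
    by (intro even_card_involution finite_zagier_set) (auto simp: zagier_set_def algebra_simps)
  moreover have "even (card ?S) \<longleftrightarrow> even (card {t \<in> ?S. zagier t = t})"
    using odd assms(2) by (intro even_card_involution finite_zagier_set zagier_involution)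
  moreover have "card {t \<in> ?S. ?f t = t} = card {(x, y). x ^ 2 + 4 * y ^ 2 = m}"
  proof (rule bij_betw_same_card[of "\<lambda>(x, y, z). (nat x, nat y)"], rule bij_betw_imageI)
    show "inj_on (\<lambda>(x, y, z). (nat x, nat y)) {t \<in> ?S. ?f t = t}"
      by (rule inj_onI) (auto simp: zagier_set_def)
    show "(\<lambda>(x, y, z). (nat x, nat y)) ` {t \<in> ?S. ?f t = t} = {(x, y). x ^ 2 + 4 * y ^ 2 = m}"
    proof (intro equalityI subsetI)
      fix w assume "w \<in> (\<lambda>(x, y, z). (nat x, nat y)) ` {t \<in> ?S. ?f t = t}"
      then obtain x y where "w = (nat x, nat y)" "x > 0" "y > 0" "x * x + 4 * y * y = int m"
        by (auto simp: zagier_set_def)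
      moreover from this have "int (nat x ^ 2 + 4 * nat y ^ 2) = int m"
        by (simp add: power2_eq_square)
      then have "nat x ^ 2 + 4 * nat y ^ 2 = m" by (simp only: of_nat_eq_iff)
      ultimately show "w \<in> {(x, y). x ^ 2 + 4 * y ^ 2 = m}" by simp
    next
      fix w :: "nat \<times> nat" assume "w \<in> {(x, y). x ^ 2 + 4 * y ^ 2 = m}"
      then obtain x y where xy: "w = (x, y)" "x ^ 2 + 4 * y ^ 2 = m" by auto
      have "x \<noteq> 0" using xy(2) odd by (auto intro: odd_pos)
      moreover have "y \<noteq> 0" using xy(2) assms(2) by (metis add.right_neutral is_nth_power_nth_power mult_0_right zero_power2)
      moreover have "int x * int x + 4 * int y * int y = int m"
        unfolding xy(2)[symmetric] by (simp add: power2_eq_square)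
      ultimately have "(int x, int y, int y) \<in> {t \<in> ?S. ?f t = t}" by (simp add: zagier_set_def)
      then show "w \<in> (\<lambda>(x, y, z). (nat x, nat y)) ` {t \<in> ?S. ?f t = t}" 
        using xy(1) by force
    qed
  qed
  moreover have "card {t \<in> ?S. zagier t = t} = card {d. d dvd m \<and> d * d < m}"
  proof (rule bij_betw_same_card[of "\<lambda>(x, y, z). nat x"], rule bij_betw_imageI)
    \<comment> \<open>The outer branches change x by 2z or 2y, so a fixed point lies in the middle
      branch, where 2y - x = x.\<close>
    have fixed: "x = y \<and> x * (x + 4 * z) = int m \<and> x > 0 \<and> z > 0" if "(x, y, z) \<in> ?S" "zagier (x, y, z) = (x, y, z)" for x y z
    proof -
      have *: "x > 0" "y > 0" "z > 0" "x * x + 4 * y * z = int m"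
        using that(1) by (auto simp: zagier_set_def)
      moreover have "x = y"
        using that(2) *(1-3) unfolding zagier_def prod.case by (smt (verit) Pair_inject)
      ultimately show ?thesis by (simp add: distrib_left mult_ac)
    qed
    show "inj_on (\<lambda>(x, y, z). nat x) {t \<in> ?S. zagier t = t}"
    proof (rule inj_onI)
      fix t t'
      assume t: "t \<in> {t \<in> ?S. zagier t = t}" "t' \<in> {t \<in> ?S. zagier t = t}"
        "(\<lambda>(x, y, z). nat x) t = (\<lambda>(x, y, z). nat x) t'"
      obtain x y z x' y' z' where xyz: "t = (x, y, z)" "t' = (x', y', z')"
        by (cases t, cases t')
      then have a: "(x, y, z) \<in> ?S" "(x', y', z') \<in> ?S" "zagier (x, y, z) = (x, y, z)"
        "zagier (x', y', z') = (x', y', z')" "nat x = nat x'"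
        using t by simp_all
      note f = fixed[OF a(1,3)] fixed[OF a(2,4)]
      then have "x = x'" using a(5) by auto
      then have "x * (x + 4 * z) = x * (x + 4 * z')" using f by metis
      moreover have "x \<noteq> 0" using f(1) by auto
      ultimately have "z = z'" by simp
      then show "t = t'" using \<open>x = x'\<close> f xyz by simp
    qed
    show "(\<lambda>(x, y, z). nat x) ` {t \<in> ?S. zagier t = t} = {d. d dvd m \<and> d * d < m}"
    proof (intro equalityI subsetI)
      fix d assume "d \<in> (\<lambda>(x, y, z). nat x) ` {t \<in> ?S. zagier t = t}"
      then obtain x y z where "(x, y, z) \<in> ?S" "zagier (x, y, z) = (x, y, z)" and d: "d = nat x" by auto
      note f = fixed[OF this(1,2)]
      then have "int d * (int d + 4 * z) = int m" "z > 0" "d > 0" using d by auto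
      moreover from this have "0 < int d * (4 * z)" by simp
      then have "int d * int d < int m" using calculation(1) by (simp add: algebra_simps)
      then have "d * d < m" by (metis of_nat_less_iff of_nat_mult)
      moreover have "int d dvd int m" using calculation(1) by (metis dvd_triv_left)
      ultimately show "d \<in> {d. d dvd m \<and> d * d < m}" by simp
    next
      fix d assume d: "d \<in> {d. d dvd m \<and> d * d < m}"
      then obtain e where e: "m = d * e" by (auto elim: dvdE)
      have "d < e" "d > 0" using d e by auto
      \<comment> \<open>Two residues modulo 4 with product 1 are both 1 or both 3. The difference e
        - d is thus a multiple of 4, and z is a quarter of it.\<close>
      have "d mod 4 = e mod 4"
      proof -
        have "(d mod 4) * (e mod 4) mod 4 = 1" using assms(1) e by (simp add: mod_mult_eq)
        moreover have "d mod 4 \<in> {0,1,2,3}" "e mod 4 \<in> {0,1,2,3}" by auto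
        ultimately show ?thesis by auto
      qed
      then have "4 dvd e - d" using \<open>d < e\<close> mod_eq_dvd_iff_nat[of d e 4] by simp
      then obtain z where "e - d = 4 * z" ..
      then have z: "e = d + 4 * z" "z > 0" using \<open>d < e\<close> by auto
      have "int m = int d * (int d + 4 * int z)" unfolding e z by simp
      then have "(int d, int d, int z) \<in> ?S" "zagier (int d, int d, int z) = (int d, int d, int z)"
        using \<open>d > 0\<close> \<open>z > 0\<close> by (auto simp: zagier_set_def zagier_def algebra_simps)
      then show "d \<in> (\<lambda>(x, y, z). nat x) ` {t \<in> ?S. zagier t = t}" by force
    qed
  qed
  ultimately show ?thesis by simp
qed

section \<open>Divisor counts\<close>

lemma card_divisors_nonsquare:
  fixes m :: nat
  assumes "m > 0" "\<not> is_square m"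
  shows "card {d. d dvd m} = 2 * card {d. d dvd m \<and> d * d < m}"
proof -
  let ?A = "{d. d dvd m \<and> d * d < m}" and ?B = "{d. d dvd m \<and> m < d * d}"
  have fin: "finite {d. d dvd m}" using assms by simp
  have "d * d \<noteq> m" for d using assms(2) by (metis is_nth_power_nth_power power2_eq_square)
  then have un: "{d. d dvd m} = ?A \<union> ?B" by (auto simp: neq_iff)
  have "card (?A \<union> ?B) = card ?A + card ?B"
    using fin by (intro card_Un_disjoint) (auto intro: finite_subset)
  moreover have "card ?A = card ?B"
  proof (rule bij_betw_same_card[of "\<lambda>d. m div d"], rule bij_betw_byWitness[where f' = "\<lambda>d. m div d"])
    have *: "d * (m div d) = m" "m div d dvd m" if "d dvd m" for d using that by (auto simp: div_dvd_iff_mult)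
    show "\<forall>d\<in>?A. m div (m div d) = d" "\<forall>d\<in>?B. m div (m div d) = d"
      using assms(1) by (auto simp: div_div_eq_right)
    have "m < (m div d) * (m div d) \<longleftrightarrow> d * d < m" if "d dvd m" for d
    proof -
      obtain e where e: "m = d * e" using \<open>d dvd m\<close> by (elim dvdE)
      then have "d > 0" "e > 0" using assms(1) by auto
      then show ?thesis using e by simp
    qed
    moreover have "(m div d) * (m div d) < m \<longleftrightarrow> m < d * d" if "d dvd m" for d
    proof -
      obtain e where e: "m = d * e" using \<open>d dvd m\<close> by (elim dvdE)
      then have "d > 0" "e > 0" using assms(1) by auto
      then show ?thesis using e by simp
    qed
    ultimately show "(\<lambda>d. m div d) ` ?A \<subseteq> ?B" "(\<lambda>d. m div d) ` ?B \<subseteq> ?A" using *(2) by auto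
  qed
  ultimately show ?thesis unfolding un by simp
qed

lemma card_divisors_mult:
  fixes m n :: nat
  assumes "coprime m n"
  shows "card {d. d dvd m * n} = card {d. d dvd m} * card {d. d dvd n}"
proof -
  have "bij_betw (\<lambda>(d, e). d * e) ({d. d dvd m} \<times> {d. d dvd n}) {d. d dvd m * n}"
  proof (rule bij_betw_imageI)
    show "inj_on (\<lambda>(d, e). d * e) ({d. d dvd m} \<times> {d. d dvd n})"
    proof (rule inj_onI, clarify)
      fix d e d' e' assume *: "d dvd m" "e dvd n" "d' dvd m" "e' dvd n" "d * e = d' * e'"
      then have "coprime d e'" "coprime d' e" "coprime d e" "coprime d' e'"
        using assms by (meson coprime_divisors)+
      then have "d dvd d'" "d' dvd d" "e dvd e'" "e' dvd e"
        using *(5) by (metis coprime_dvd_mult_left_iff coprime_dvd_mult_right_iff coprime_commute dvd_triv_left dvd_triv_right)+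
      then show "d = d' \<and> e = e'" by (auto intro: dvd_antisym)
    qed
    show "(\<lambda>(d, e). d * e) ` ({d. d dvd m} \<times> {d. d dvd n}) = {d. d dvd m * n}"
      by (auto simp: image_def intro: mult_dvd_mono) (metis division_decomp)
  qed
  then show ?thesis using bij_betw_same_card by (fastforce simp: card_cartesian_product)
qed

lemma card_divisors_prime_power:
  fixes p :: nat
  assumes "prime p"
  shows "card {d. d dvd p ^ n} = n + 1"
proof -
  have "{d. d dvd p ^ n} = (\<lambda>i. p ^ i) ` {..n}"
    using assms by (auto simp: divides_primepow_nat le_imp_power_dvd)
  moreover have "inj_on (\<lambda>i. p ^ i) {..n}"
    using assms prime_gt_1_nat by (auto simp: inj_on_def)
  ultimately show ?thesis by (simp add: card_image)
qed

section \<open>The main theorem\<close>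

lemma even_nu: "even (nu p)"
  by (simp add: nu_def)

text \<open>Since s is odd, a pure power of s decides: r is even if nu = 4, and if nu = 8 the terms
  r^6 s and 5 s^2 r^4 have equal parity and cancel modulo 2.\<close>

lemma odd_g:
  assumes "odd p"
  shows "odd (g p)"
proof -
  have "even (r p)" if "nu p = 4"
    using that by (auto simp: nu_def split: if_splits) presburger
  then show ?thesis using assms by (auto simp: g_def s_def)
qed

text \<open>In x^2 + 4y^2 = 4n + 1 the number x = 2j + 1 is odd and n = j(j + 1) + y^2, so y has the
  parity of n. For even n no representation with odd y exists; for odd n every representation has
  odd y and the divisor count decides.\<close>

lemma b_even_mod_72:
  assumes "\<not> is_square (4 * n + 1)" "9 dvd 4 * n + 1"
  shows "even n \<or> 4 dvd card {d. d dvd 4 * n + 1} \<Longrightarrow> [b (2 * n) = 0] (mod 72)"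
    and "odd n \<Longrightarrow> \<not> 4 dvd card {d. d dvd 4 * n + 1} \<Longrightarrow> [b (2 * n) = 36] (mod 72)"
proof -
  let ?S = "{(x :: nat, y :: nat). x ^ 2 + 4 * y ^ 2 = 4 * n + 1 \<and> odd y}"
  define c where "c = int (card ?S)"
  have "n mod 3 = 2" using assms(2) by presburger
  then obtain l where "n = 3 * l + 2" by (metis mult_div_mod_eq)
  then have 9: "9 dvd b (2 * n)" using B_even_mod_9[of l] by (simp add: B_even_def)
  have 8: "[b (2 * n) = 4 * c] (mod 8)" unfolding c_def by (rule b_even_mod_8[OF assms(1)])
  have odd: "odd x \<and> (odd y \<longleftrightarrow> odd n)" if "x ^ 2 + 4 * y ^ 2 = 4 * n + 1" for x y :: nat
  proof -
    have x: "odd x" using arg_cong[OF that, of even] by simp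
    then obtain j where j: "x = 2 * j + 1" by (elim oddE)
    then have "n = j * (j + 1) + y ^ 2" using that by (simp add: power2_eq_square algebra_simps)
    then show ?thesis using x by simp
  qed
  have S: "even (card ?S) \<longleftrightarrow> even n \<or> 4 dvd card {d. d dvd 4 * n + 1}"
  proof (cases "even n")
    case True
    then have S0: "?S = {}" using odd by auto
    show ?thesis unfolding S0 using True by simp
  next
    case False
    then have S1: "?S = {(x, y). x ^ 2 + 4 * y ^ 2 = 4 * n + 1}" using odd by auto
    have "(4 * n + 1) mod 4 = 1" by presburger
    then have "even (card ?S) \<longleftrightarrow> even (card {d. d dvd 4 * n + 1 \<and> d * d < 4 * n + 1})"
      unfolding S1 by (rule card_two_squares_parity[OF _ assms(1)])
    moreover have "4 dvd 2 * k \<longleftrightarrow> even k" for k :: nat by presburger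
    moreover have "card {d. d dvd 4 * n + 1} = 2 * card {d. d dvd 4 * n + 1 \<and> d * d < 4 * n + 1}"
      by (rule card_divisors_nonsquare[OF _ assms(1)]) simp
    ultimately show ?thesis using False by (simp only:) simp
  qed
  show "[b (2 * n) = 0] (mod 72)" if "even n \<or> 4 dvd card {d. d dvd 4 * n + 1}"
  proof -
    have "even c" using S that unfolding c_def by (simp only: even_of_nat simp_thms)
    then have "8 dvd b (2 * n)" using 8 unfolding cong_def by presburger
    then show ?thesis using 9 unfolding cong_0_iff by presburger
  qed
  show "[b (2 * n) = 36] (mod 72)" if "odd n" "\<not> 4 dvd card {d. d dvd 4 * n + 1}"
  proof -
    have "odd c" using S that unfolding c_def by (simp only: even_of_nat simp_thms)
    then obtain d where "c = 2 * d + 1" by (elim oddE)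
    \<comment> \<open>Here 4c = 8d + 4, rewritten to exhibit the residue 36 that is also divisible
      by 9.\<close>
    then have "[b (2 * n) = 36 + 8 * (d - 4)] (mod 8)" using 8 by (simp add: add.commute)
    also have "[36 + 8 * (d - 4) = 36] (mod 8)" by (simp add: cong_iff_dvd_diff)
    finally have "8 dvd b (2 * n) - 36" by (simp add: cong_iff_dvd_diff)
    moreover have "9 dvd b (2 * n) - 36" using 9 by simp
    ultimately show ?thesis unfolding cong_iff_dvd_diff by presburger
  qed
qed

lemma not_square_odd_prime_power:
  fixes p :: nat
  assumes "prime p" "odd e" "\<not> p dvd c" "c > 0"
  shows "\<not> is_square (p ^ e * c)"
proof
  assume "is_square (p ^ e * c)"
  then obtain k where k: "p ^ e * c = k ^ 2" by (auto elim: is_nth_powerE)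
  have "k \<noteq> 0" using k assms by (metis mult_eq_0_iff power_not_zero not_prime_0 zero_power2 neq0_conv)
  have "e = multiplicity p (p ^ e * c)"
    using assms by (simp add: prime_elem_multiplicity_mult_distrib not_dvd_imp_multiplicity_0)
  also have "\<dots> = 2 * multiplicity p k"
    unfolding k using assms(1) \<open>k \<noteq> 0\<close> by (simp add: prime_elem_multiplicity_power_distrib)
  finally show False using assms(2) by simp
qed

lemma odd_power_mod_8:
  fixes p :: nat
  assumes "odd p" "even e"
  shows "p ^ e mod 8 = 1"
proof -
  obtain l where l: "e = 2 * l" using assms(2) by (elim evenE)
  have "odd (p ^ l)" using assms(1) by simp
  then obtain j where j: "p ^ l = 2 * j + 1" by (elim oddE)
  have "p ^ e = (2 * j + 1) ^ 2" unfolding l j[symmetric] by (simp add: power_mult mult.commute)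
  also have "\<dots> = 4 * (j * (j + 1)) + 1" by (simp add: power2_eq_square algebra_simps)
  also have "even (j * (j + 1))" by simp
  then obtain h where "j * (j + 1) = 2 * h" by (elim evenE)
  finally show ?thesis by simp
qed

lemma card_divisors_prime_power_mult:
  fixes p :: nat
  assumes "prime p" "\<not> p dvd c"
  shows "card {d. d dvd p ^ e * c} = (e + 1) * card {d. d dvd c}"
proof -
  have "coprime (p ^ e) c"
    using assms by (intro coprime_power_left_iff[THEN iffD2] disjI1 prime_imp_coprime)
  then show ?thesis
    using assms by (simp only: card_divisors_mult card_divisors_prime_power)
qed

theorem theorem1p12:
  fixes p :: nat
  assumes "prime p" and "p \<ge> 3"
  shows "(\<forall>n k::nat. \<not> p dvd n \<longrightarrow>
            [b (18 * p ^ (2 * nu p * (k + 1) - 1) * n + (9 * p ^ (2 * nu p * (k + 1)) - 1) div 2) = 0] (mod 72))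
       \<and> (\<forall>k::nat.
            [b (18 * p ^ (2 * nu p * k) + (9 * p ^ (2 * nu p * k) - 1) div 2) = 36 * g p ^ k] (mod 72))"
proof (intro conjI allI impI)
  have odd: "odd p" using assms prime_odd_nat by auto
  {
    fix n k :: nat
    assume n: "\<not> p dvd n"
    define M where "M = 2 * nu p * (k + 1)"
    have M: "4 dvd M" "M > 0"
      using even_nu[of p] by (auto simp: M_def nu_def)
    \<comment> \<open>The exponent e is 3 modulo 4, so that p^e alone contributes the factor e + 1,
      a multiple of 4, to the divisor count if p differs from 3.\<close>
    then obtain e where e: "M = Suc e" by (cases M) auto
    then have "odd e" using M(1) by presburger
    define m where "m = 9 * p ^ e * (4 * n + p)"
    define N where "N = 18 * p ^ e * n + (9 * p ^ M - 1) div 2"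
    define A q where "A = p ^ e * n" and "q = p ^ M"
    have m: "m = 36 * A + 9 * q" by (simp add: m_def A_def q_def e algebra_simps)
    have q: "q mod 8 = 1" unfolding q_def using M odd by (intro odd_power_mod_8) auto
    then obtain u where u: "q = 8 * u + 1" by (metis mult_div_mod_eq)
    \<comment> \<open>With q = 8u + 1, the argument of b is N = 18A + 36u + 4 = 2l, and m = 2N + 1 =
      4l + 1.\<close>
    define l where "l = 9 * A + 18 * u + 2"
    have l: "m = 4 * l + 1" by (simp add: m u l_def)
    have "N = 18 * A + (9 * q - 1) div 2" by (simp add: N_def A_def q_def)
    then have N: "N = 2 * l" by (simp add: u l_def)
    have "coprime p (2 ^ 2)" using odd by (simp only: coprime_power_right_iff coprime_right_2_iff_odd simp_thms)
    then have "p dvd 4 * n \<longleftrightarrow> p dvd n"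
      using coprime_dvd_mult_right_iff[of p 4 n] by simp
    then have pn: "\<not> p dvd 4 * n + p" using n by simp
    have "\<not> is_square m \<and> 4 dvd card {d. d dvd m}"
    proof (cases "p = 3")
      case True
      \<comment> \<open>For p = 3 the 9 merges with the prime power and e + 3 is only 2 modulo 4.
        The missing factor 2 comes from 4n + 3, which is 3 modulo 4, hence not a square, and so has
        an even number of divisors.\<close>
      have m3: "m = 3 ^ (e + 2) * (4 * n + 3)" by (simp add: m_def True)
      have 3: "\<not> 3 dvd 4 * n + 3" "prime (3::nat)" using pn assms(1) unfolding True by auto
      have "\<not> is_square (4 * n + 3)"
      proof
        assume "is_square (4 * n + 3)"
        then obtain j where "4 * n + 3 = j ^ 2" by (auto elim: is_nth_powerE)
        moreover have "j ^ 2 mod 4 = 0 \<or> j ^ 2 mod 4 = 1"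
        proof -
          have "j mod 4 \<in> {0, 1, 2, 3}" by auto
          then have "(j mod 4) ^ 2 mod 4 = 0 \<or> (j mod 4) ^ 2 mod 4 = 1" by auto
          then show ?thesis by (simp add: power_mod)
        qed
        ultimately show False by presburger
      qed
      then have "even (card {d. d dvd 4 * n + 3})"
        by (subst card_divisors_nonsquare) auto
      moreover have "card {d. d dvd m} = (e + 2 + 1) * card {d. d dvd 4 * n + 3}"
        unfolding m3 using 3 by (intro card_divisors_prime_power_mult)
      moreover have "even (e + 2 + 1)" using \<open>odd e\<close> by simp
      ultimately have "2 * 2 dvd card {d. d dvd m}" using mult_dvd_mono by metis
      moreover have "\<not> is_square m"
        unfolding m3 using 3 \<open>odd e\<close> by (intro not_square_odd_prime_power) auto
      ultimately show ?thesis by simp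
    next
      case False
      have m9: "m = p ^ e * (9 * (4 * n + p))" by (simp add: m_def)
      have "\<not> p dvd 9"
      proof
        assume "p dvd 9"
        then have "p dvd 3 ^ 2" by simp
        then have "p dvd 3" using assms(1) prime_dvd_power by blast
        then show False using False assms(2) by (auto dest: dvd_imp_le)
      qed
      then have c: "\<not> p dvd 9 * (4 * n + p)" using pn assms(1) \<open>\<not> p dvd 9\<close> by (metis prime_dvd_mult_iff)
      then have "card {d. d dvd m} = (e + 1) * card {d. d dvd 9 * (4 * n + p)}"
        unfolding m9 using assms(1) by (intro card_divisors_prime_power_mult)
      moreover have "4 dvd e + 1" using M(1) e by simp
      ultimately have "4 dvd card {d. d dvd m}" by (metis dvd_mult2)
      moreover have "\<not> is_square m"
        unfolding m9 using assms c \<open>odd e\<close> by (intro not_square_odd_prime_power) auto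
      ultimately show ?thesis by simp
    qed
    moreover have "9 dvd m" by (simp add: m_def)
    ultimately have "[b N = 0] (mod 72)"
      unfolding N using b_even_mod_72(1)[of l] l by simp
    then show "[b (18 * p ^ (2 * nu p * (k + 1) - 1) * n + (9 * p ^ (2 * nu p * (k + 1)) - 1) div 2) = 0] (mod 72)"
      unfolding N_def M_def[symmetric] by (simp add: e)
  }
  {
    fix k :: nat
    define K where "K = 2 * nu p * k"
    have K: "4 dvd K" using even_nu[of p] by (auto simp: K_def)
    define q where "q = p ^ K"
    define m where "m = 45 * q"
    define N where "N = 18 * q + (9 * q - 1) div 2"
    have q: "q mod 8 = 1" unfolding q_def using K odd by (intro odd_power_mod_8) auto
    then obtain u where u: "q = 8 * u + 1" by (metis mult_div_mod_eq)
    \<comment> \<open>With q = 8u + 1, 45q = 360u + 45 = 4(90u + 11) + 1. This l is odd, which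
      selects the residue 36.\<close>
    define l where "l = 90 * u + 11"
    have l: "m = 4 * l + 1" and N: "N = 2 * l" and "odd l"
      by (simp_all add: m_def N_def u l_def)
    have "m = 5 + 8 * (45 * u + 5)" by (simp add: m_def u)
    then have m8: "m mod 8 = 5" by (simp only: mod_mult_self2) simp
    have "\<not> is_square m"
    proof
      assume "is_square m"
      then obtain j where j: "m = j ^ 2" by (auto elim: is_nth_powerE)
      moreover have "odd m" using l by simp
      ultimately have "odd j" by simp
      then show False using odd_power_mod_8[of j 2] j m8 by simp
    qed
    moreover have "9 dvd m" by (simp add: m_def)
    moreover have "\<not> 4 dvd card {d. d dvd m}"
    proof -
      have tau: "card {d :: nat. d dvd 5} = 2" "card {d :: nat. d dvd 9} = 3" "card {d :: nat. d dvd 45} = 6"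
        using card_divisors_prime_power[of "5::nat" 1] card_divisors_prime_power[of "3::nat" 2]
          card_divisors_prime_power_mult[of "3::nat" 5 2] by simp_all
      \<comment> \<open>The prime p may merge with the 9 or the 5 of 45. The divisor counts are 2(K
        + 3), 3(K + 2) and 6(K + 1), all 2 modulo 4 because 4 divides K.\<close>
      consider "p = 3" | "p = 5" | "p \<noteq> 3" "p \<noteq> 5" by blast
      then show ?thesis
      proof cases
        case 1
        have "m = 3 ^ (K + 2) * 5" by (simp add: m_def q_def 1)
        then have "card {d. d dvd m} = (K + 2 + 1) * 2"
          using card_divisors_prime_power_mult[of "3::nat" 5 "K + 2"] tau by simp
        then show ?thesis using K by presburger
      next
        case 2
        have "m = 5 ^ (K + 1) * 9" by (simp add: m_def q_def 2)
        then have "card {d. d dvd m} = (K + 1 + 1) * 3"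
          using card_divisors_prime_power_mult[of "5::nat" 9 "K + 1"] tau by simp
        then show ?thesis using K by presburger
      next
        case 3
        have "\<not> p dvd 3 ^ 2 * 5"
        proof
          assume "p dvd 3 ^ 2 * 5"
          then have "p dvd 3 \<or> p dvd 5"
            using assms(1) prime_dvd_mult_iff prime_dvd_power by blast
          then show False using 3 assms(1) by (auto simp: primes_dvd_imp_eq dest: primes_dvd_imp_eq)
        qed
        then have "card {d. d dvd p ^ K * 45} = (K + 1) * 6"
          using card_divisors_prime_power_mult[OF assms(1), of 45 K] tau by simp
        then have "card {d. d dvd m} = (K + 1) * 6"
          by (simp add: m_def q_def mult.commute)
        then show ?thesis using K by presburger
      qed
    qed
    ultimately have "[b N = 36] (mod 72)"
      unfolding N using b_even_mod_72(2)[of l] l \<open>odd l\<close> by simp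
    moreover have "odd (g p ^ k)" using odd_g[OF odd] by simp
    then obtain h where "g p ^ k = 2 * h + 1" by (elim oddE)
    then have "[36 = 36 * g p ^ k] (mod 72)" by (simp add: cong_iff_dvd_diff)
    ultimately show "[b (18 * p ^ (2 * nu p * k) + (9 * p ^ (2 * nu p * k) - 1) div 2) = 36 * g p ^ k] (mod 72)"
      unfolding N_def q_def K_def by (rule cong_trans)
  }
qed

end
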